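(* Let $p$ be an odd prime and $r\ge1$ an integer. Then $$\sum_{k=0}^{p^r-1}(3k+1)\frac{(\frac12)_k^3}{(1)_k^3}4^k\equiv\sum_{k=0}^{(p^r-1)/2}(4k+1)\frac{(\frac12)_k^4}{(1)_k^4}\pmod{p^{r+4}}.$$
   Context: $(x)_k=x(x+1)\cdots(x+k-1)$ is the Pochhammer symbol, with $(x)_0=1$. A congruence $a\equiv b\pmod{p^m}$ between rational numbers means that $(a-b)/p^m$ is a rational number whose denominator is not divisible by $p$. *)

theory Defs
  imports Complex_Main "HOL-Computational_Algebra.Primes"
begin

definition rat_cong :: "rat \<Rightarrow> rat \<Rightarrow> nat \<Rightarrow> nat \<Rightarrow> bool" where
  "rat_cong a b p m \<longleftrightarrow>
     \<not> (int p dvd snd (quotient_of ((a - b) / of_nat (p ^ m))))"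

end

theory Submission
  imports Defs "HOL-Computational_Algebra.Fundamental_Theorem_Algebra"
begin

text \<open>Both sides are the values at \<open>q = 1\<close> of q-analogues, and with \<open>n = p^r\<close> it suffices that the
  difference of these is divisible by \<open>[n] * \<Phi>_n(q)^4\<close>, where \<open>[n] = 1 + q + \<dots> + q^(n-1)\<close> and
  \<open>\<Phi>_n\<close> is the cyclotomic polynomial: this product is monic and takes the value \<open>p^(r+4)\<close> at \<open>1\<close>,
  while the denominators are powers of \<open>2\<close> there.

  Two WZ pairs show that \<open>(1-q)\<close> times the left-hand sum is \<open>\<Sum>j<n. (1 - q^(4*j+1)) * T_j * v_j\<close>, where
  \<open>T_j = ((q;q^2)_j / (q^2;q^2)_j)^4\<close>, where \<open>v_j = 1\<close> for \<open>2*j < n\<close>, and where the differences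
  \<open>v_(j+1) - v_j\<close> are explicit products. The terms with \<open>2*j < n\<close> give the right-hand sum. In the others, near
  a primitive \<open>n\<close>-th root of unity, \<open>T_j\<close> vanishes to order four and all \<open>v_j\<close> have the same limit, so
  the coefficient of order four is a multiple of a sum that is cancelled by the reflection
  \<open>j \<mapsto> (3*n-1)/2 - j\<close>; hence the difference vanishes to order five. At roots of unity of smaller
  order \<open>d > 1\<close> both sums decompose into blocks of length \<open>d\<close>, each proportional to the sum for
  \<open>n = d\<close>, which vanishes.\<close>

subsection \<open>Two WZ pairs\<close>

definition qpoch :: "'a::field \<Rightarrow> 'a \<Rightarrow> nat \<Rightarrow> 'a" where
  "qpoch a q k = (\<Prod>i<k. 1 - a * q ^ i)"

lemma qpoch_0 [simp]: "qpoch a q 0 = 1"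
  by (simp add: qpoch_def)

lemma qpoch_Suc: "qpoch a q (Suc k) = qpoch a q k * (1 - a * q ^ k)"
  by (simp add: qpoch_def)

text \<open>Reciprocal q-factorials are extended by \<open>0\<close> to negative indices, so that the recurrences
  below hold without boundary cases and sums over \<open>j \<le> k \<le> 2 * j\<close> terminate naturally.\<close>

definition rqpoch :: "'a::field \<Rightarrow> int \<Rightarrow> 'a" where
  "rqpoch q i = (if i < 0 then 0 else inverse (qpoch q q (nat i)))"

text \<open>These coefficients are, up to the factor \<open>(1 - q^(4*j+1)) / (1 - q)\<close>, those of the partial
  fraction decomposition in \<open>b\<close> of the factor
  \<open>(b;q)_k (q/b;q)_k / ((q^3/b;q^2)_k (b q^2;q^2)_k)\<close> of Rahman's quadratic summation at the poles
  \<open>b = q^(-2*j)\<close>; the congruence concerns the limit where \<open>b\<close> tends to infinity.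
  The exponent \<open>\<Sum>{..k}\<close> is \<open>k (k+1) / 2\<close>.\<close>

definition wz_coeff :: "'a::field \<Rightarrow> nat \<Rightarrow> nat \<Rightarrow> 'a" where
  "wz_coeff q k j = (-1) ^ (k + j)
     * q powi (int (\<Sum>{..k}) + int j * (int j - 1) - 2 * int j * int k)
     * qpoch q q (2 * j + k) * qpoch q (q^2) j
     * rqpoch q (2 * int j - int k) * rqpoch (q^2) (int k - int j)
     / (qpoch q (q^2) (j + k + 1) * qpoch (q^2) (q^2) j)"

text \<open>The limit for q tending to 1 is (1/2)_k^3 4^k / (1)_k^3: each (q;q^2)_k contributes a
  factor 2^k, and (q^2;q^2)_k takes one of the three back.\<close>

definition lhs_weight :: "'a::field \<Rightarrow> nat \<Rightarrow> 'a" where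
  "lhs_weight q k = qpoch q (q^2) k ^ 3 / (qpoch q q k ^ 2 * qpoch (q^2) (q^2) k)"

definition rhs_root :: "'a::field \<Rightarrow> nat \<Rightarrow> 'a" where
  "rhs_root q j = qpoch q (q^2) j / qpoch (q^2) (q^2) j"

text \<open>Dividing by \<open>rhs_root q j ^ 4\<close> normalises the sum over \<open>k\<close> to
  1 in the range of \<open>wz_A_sum\<close>. In the same way, \<open>wz_B\<close> below is
  normalised to have sum 1 over \<open>j\<close>.\<close>

definition wz_A :: "'a::field \<Rightarrow> nat \<Rightarrow> nat \<Rightarrow> 'a" where
  "wz_A q k j = (1 - q ^ (3*k+1)) * lhs_weight q k * wz_coeff q k j / rhs_root q j ^ 4"

text \<open>The rational multiple of \<open>wz_A\<close> that makes \<open>(wz_A, wz_G)\<close> a WZ pair; likewise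
  \<open>wz_H\<close> for \<open>wz_B\<close>. Both were found by interpolating numerical values.\<close>

definition wz_G :: "'a::field \<Rightarrow> nat \<Rightarrow> nat \<Rightarrow> 'a" where
  "wz_G q k j = (-1) ^ (k + j)
     * q powi (int (\<Sum>{..k}) + int j * (int j - 1) - 2 * int j * int k + 2 + 4 * int j - 3 * int k)
     * (1 - q ^ (4*j+3)) * (1 - q ^ k) ^ 3 * (1 - q ^ (2*k))
     * qpoch q (q^2) k ^ 3 * qpoch q q (2 * j + k) * qpoch (q^2) (q^2) j ^ 3
     * rqpoch q (2 * int j + 2 - int k) * rqpoch (q^2) (int k - int j - 1)
     / (qpoch q q k ^ 2 * qpoch (q^2) (q^2) k * qpoch q (q^2) (j + k + 1) * qpoch q (q^2) (Suc j) ^ 3)"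

definition wz_B :: "'a::field \<Rightarrow> nat \<Rightarrow> nat \<Rightarrow> 'a" where
  "wz_B q k j = (1 - q ^ (4*j+1)) * q ^ (\<Sum>{..k}) * wz_coeff q k j"

definition wz_H :: "'a::field \<Rightarrow> nat \<Rightarrow> nat \<Rightarrow> 'a" where
  "wz_H q k j = (-1) ^ (k + j) * q ^ (\<Sum>{..k})
     * q powi (int (\<Sum>{..k}) + int j * (int j - 1) - 2 * int j * int k + 2 + 2 * int k - 2 * int j)
     * (1 - q ^ (2*j)) * (1 - q ^ (3*k+3))
     * qpoch q q (2 * j + k) * qpoch q (q^2) j
     * rqpoch q (2 * int j - int k - 2) * rqpoch (q^2) (int k + 1 - int j)
     / (qpoch q (q^2) (j + k + 1) * qpoch (q^2) (q^2) j * (1 - q ^ (2*k+2)) * (1 - q ^ (k+1)))"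

locale generic_base =
  fixes q :: "'a::field"
  assumes q_nonzero [simp]: "q \<noteq> 0"
    and q_not_root: "i > 0 \<Longrightarrow> q ^ i \<noteq> 1"
begin

lemma factor_nonzero: "i > 0 \<Longrightarrow> 1 - q ^ i \<noteq> 0"
  using q_not_root by force

lemma qpoch_nonzero [simp]:
  "qpoch q q k \<noteq> 0" "qpoch q (q^2) k \<noteq> 0" "qpoch (q^2) (q^2) k \<noteq> 0"
proof -
  have "1 - q * q ^ i \<noteq> 0" "1 - q * (q^2) ^ i \<noteq> 0" "1 - q^2 * (q^2) ^ i \<noteq> 0" for i
    using factor_nonzero[of "Suc i"] factor_nonzero[of "Suc (2*i)"] factor_nonzero[of "2 * Suc i"]
    by (simp_all add: power_mult power2_eq_square mult.assoc)
  then show "qpoch q q k \<noteq> 0" "qpoch q (q^2) k \<noteq> 0" "qpoch (q^2) (q^2) k \<noteq> 0"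
    by (simp_all add: qpoch_def)
qed

lemma rhs_root_nonzero [simp]: "rhs_root q j \<noteq> 0"
  by (simp add: rhs_root_def)

end

lemma rqpoch_pred:
  fixes q :: "'a::field"
  assumes "\<And>i. i > 0 \<Longrightarrow> q ^ i \<noteq> 1"
  shows "rqpoch q (i - 1) = (1 - q powi i) * rqpoch q i"
proof (cases "i \<le> 0")
  case True
  then show ?thesis by (cases "i = 0") (auto simp: rqpoch_def)
next
  case False
  then obtain k where k: "i = int (Suc k)"
    by (metis linorder_not_le pos_int_cases gr0_conv_Suc)
  have "1 - q * q ^ k \<noteq> 0"
    using assms[of "Suc k"] by simp
  moreover have "nat (int (Suc k) - 1) = k" "nat (int (Suc k)) = Suc k" "q powi int (Suc k) = q * q ^ k"
    by (simp_all del: of_nat_Suc add: power_int_of_nat)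
  ultimately show ?thesis
    unfolding k rqpoch_def by (simp add: qpoch_Suc del: of_nat_Suc)
qed

context generic_base
begin

lemma rqpoch_steps:
  "i' = i - 1 \<Longrightarrow> rqpoch q i' = (1 - q powi i) * rqpoch q i"
  "i' = i - 1 \<Longrightarrow> rqpoch (q^2) i' = (1 - q powi (2 * i)) * rqpoch (q^2) i"
proof -
  show "i' = i - 1 \<Longrightarrow> rqpoch q i' = (1 - q powi i) * rqpoch q i"
    by (simp, rule rqpoch_pred) (use q_not_root in auto)
  have "rqpoch (q^2) (i - 1) = (1 - (q^2) powi i) * rqpoch (q^2) i"
    by (rule rqpoch_pred) (use q_not_root in \<open>auto simp flip: power_mult\<close>)
  then show "i' = i - 1 \<Longrightarrow> rqpoch (q^2) i' = (1 - q powi (2 * i)) * rqpoch (q^2) i"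
    by (simp add: power_int_mult)
qed

text \<open>After extraction of one hypergeometric term \<open>C\<close>, the WZ equation is the
  polynomial identity \<open>wzid\<close> in q, S and t.\<close>

lemma wz_A_step:
  "wz_A q k (Suc j) - wz_A q k j = wz_G q (Suc k) j - wz_G q k j"
proof -
  \<comment> \<open>In terms of these, q^k = S*t and q^(2*j) = S*t^2 are monomials. Moreover S and t
    are the powers that enter when the index of either \<open>rqpoch\<close> moves by one.\<close>
  define S where "S = q powi (2 * (int k - int j))"
  define t where "t = q powi (2 * int j - int k)"
  have nz: "S \<noteq> 0" "t \<noteq> 0"
    by (auto simp: S_def t_def)
  have "q powi int k = S * t"
    unfolding S_def t_def by (subst power_int_add[symmetric]) auto
  then have x: "q ^ k = S * t"
    by simp
  have "q powi int (2 * j) = S * (t * t)"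
    unfolding S_def t_def by (simp only: q_nonzero simp_thms power_int_add[symmetric] disj_not1) auto
  then have y: "q ^ (2 * j) = S * t ^ 2"
    by (simp add: power2_eq_square del: of_nat_mult)
  have y': "(q ^ j) ^ 2 = S * t ^ 2"
    using y by (simp add: power_mult mult.commute[of 2])
  have pk: "q ^ k = S * t" "(q^2) ^ k = S^2 * t^2" "q ^ (2*k) = S^2 * t^2" "q ^ (3*k+1) = q * S^3 * t^3"
    using x by (simp_all add: power_add power_mult power_mult_distrib mult.commute[of _ k] mult.assoc
        flip: power_mult[of q 2 k])
  have pj: "(q^2) ^ j = S * t^2" "q ^ (4*j+3) = q^3 * S^2 * t^4"
  proof -
    show "(q^2) ^ j = S * t^2"
      using y by (simp add: power_mult)
    have "q ^ (4*j+3) = (q ^ (2*j))^2 * q^3"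
      by (simp flip: power_mult power_add add: ac_simps)
    also have "\<dots> = q^3 * S^2 * t^4"
      unfolding y by (simp add: power_mult_distrib mult_ac flip: power_mult)
    finally show "q ^ (4*j+3) = q^3 * S^2 * t^4" .
  qed
  have pkj: "q ^ (2*j+k) = S^2 * t^3" "(q^2) ^ (j+k) = S^3 * t^4"
    using x y pk pj by (simp_all add: power_add power2_eq_square power3_eq_cube power4_eq_xxxx)
  have wzid: "-((1-q*S^3*t^3)*(1-q*S^2*t^3)*(1-q^2*S^2*t^3)*(1-q^2*S*t^2)^3*(1-S)) - S*((1-q*S^3*t^3)*(1-q*t)*(1-q^2*t)*(1-q^3*S^3*t^4)*(1-q*S*t^2)^3)
   = -((1-q^3*S^2*t^4)*(1-q*S*t)*(1-q*S^2*t^2)^3*(1-q*S^2*t^3)*(1-q^2*t)) - (q^2*t*(1-S*t)^3*(1-S^2*t^2)*(1-S)*(1-q^3*S^2*t^4)*(1-q^3*S^3*t^4))"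
    by algebra
  define e where "e = q powi (int (\<Sum>{..k}) + int j * (int j - 1) - 2 * int j * int k)"
  define P where "P = qpoch q q (2 * j + k)"
  define R where "R = rqpoch q (2 * int j + 2 - int k)"
  define R2 where "R2 = rqpoch (q^2) (int k - int j)"
  define O1 where "O1 = qpoch q (q^2) (j + k + 1)"
  define qok qfk qek qoj qej where defs: "qok = qpoch q (q^2) k" "qfk = qpoch q q k"
    "qek = qpoch (q^2) (q^2) k" "qoj = qpoch q (q^2) j" "qej = qpoch (q^2) (q^2) j"
  have nzs: "O1 \<noteq> 0" "qok \<noteq> 0" "qfk \<noteq> 0" "qek \<noteq> 0" "qoj \<noteq> 0" "qej \<noteq> 0"
    by (simp_all add: O1_def defs)
  define O2 where "O2 = qpoch q (q^2) (Suc (j + k + 1))"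
  have O2: "O2 = O1 * (1 - q^3 * S^3 * t^4)" "O2 \<noteq> 0"
  proof -
    show "O2 \<noteq> 0"
      unfolding O2_def by (rule qpoch_nonzero)
    show "O2 = O1 * (1 - q^3 * S^3 * t^4)"
      unfolding O2_def O1_def qpoch_Suc[of _ _ "j + k + 1"] using pkj by (simp add: power2_eq_square power3_eq_cube mult_ac)
  qed
  define qoj1 where "qoj1 = qpoch q (q^2) (Suc j)"
  have qoj1: "qoj1 = qoj * (1 - q * S * t^2)" "qoj1 \<noteq> 0"
  proof -
    show "qoj1 \<noteq> 0"
      unfolding qoj1_def by (rule qpoch_nonzero)
    show "qoj1 = qoj * (1 - q * S * t^2)"
      unfolding qoj1_def defs qpoch_Suc using pj by (simp add: mult_ac)
  qed
  \<comment> \<open>\<open>C\<close> carries the longest denominators \<open>O2\<close>,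
    \<open>qoj1\<close> and the reciprocal q-factorials \<open>R\<close>, \<open>R2\<close> of
    largest index, so each of the four values is a polynomial times \<open>C\<close> or
    \<open>C / S\<close>.\<close>
  define C where "C = (-1) ^ (k+j) * e * qok^3 * P * qej^3 * R * R2 / (qfk^2 * qek * O2 * qoj1^3)"
  have t1: "q powi (2 * int j + 1 - int k) = q * t" "q powi (2 * int j + 2 - int k) = q^2 * t"
    using power_int_add[of q 1 "2 * int j - int k"] power_int_add[of q 2 "2 * int j - int k"]
    by (simp_all add: t_def algebra_simps)
  have r1: "rqpoch q (2 * int j - int k) = (1 - q * t) * rqpoch q (2 * int j + 1 - int k)"
    unfolding t1(1)[symmetric] by (rule rqpoch_steps(1)) simp
  have r2: "rqpoch q (2 * int j + 1 - int k) = (1 - q^2 * t) * R"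
    unfolding t1(2)[symmetric] R_def by (rule rqpoch_steps(1)) simp
  have r3: "rqpoch (q^2) (int k - int j - 1) = (1 - S) * R2"
    unfolding S_def R2_def by (rule rqpoch_steps(2)) simp
  have 1: "wz_A q k (Suc j) = - C / S * ((1-q*S^3*t^3)*(1-q*S^2*t^3)*(1-q^2*S^2*t^3)*(1-q^2*S*t^2)^3*(1-S))"
  proof -
    have e: "q powi (int (\<Sum>{..k}) + int (Suc j) * (int (Suc j) - 1) - 2 * int (Suc j) * int k) = e / S"
      unfolding e_def S_def by (subst power_int_diff[symmetric]) (auto simp: algebra_simps)
    have P: "qpoch q q (2 * Suc j + k) = P * (1-q*S^2*t^3) * (1-q^2*S^2*t^3)"
      using pkj by (simp add: P_def qpoch_Suc power2_eq_square mult_ac)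
    have R: "rqpoch q (2 * int (Suc j) - int k) = R" "rqpoch (q^2) (int k - int (Suc j)) = (1 - S) * R2"
      using r3 by (simp_all add: R_def algebra_simps)
    have q: "qpoch (q^2) (q^2) (Suc j) = qej * (1 - q^2*S*t^2)"
      using pj by (simp add: defs qpoch_Suc mult_ac)
    have q': "1 - q^2*S*t^2 \<noteq> 0"
      using qpoch_nonzero(3)[of "Suc j"] q by auto
    have O: "qpoch q (q^2) (Suc j + k + 1) = O2"
      by (simp add: O2_def)
    show ?thesis
      unfolding wz_A_def lhs_weight_def wz_coeff_def rhs_root_def pk e P R O
      unfolding defs(1-3)[symmetric] qoj1_def[symmetric]
      unfolding C_def
      using nzs O2(2) qoj1(2) q q' nz by (simp add: divide_simps) (simp add: power_mult_distrib power2_eq_square power3_eq_cube power4_eq_xxxx mult_ac)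
  qed
  have 2: "wz_A q k j = C * ((1-q*S^3*t^3)*(1-q*t)*(1-q^2*t)*(1-q^3*S^3*t^4)*(1-q*S*t^2)^3)"
  proof -
    have r: "rqpoch q (2 * int j - int k) = (1 - q * t) * (1 - q^2 * t) * R"
      unfolding r1 r2 R_def by (simp add: mult_ac)
    show ?thesis
      unfolding wz_A_def lhs_weight_def wz_coeff_def rhs_root_def pk r
      unfolding defs[symmetric] e_def[symmetric] P_def[symmetric] R2_def[symmetric] O1_def[symmetric]
      unfolding C_def O2 qoj1
      using nzs O2 qoj1 by (simp add: divide_simps) (simp add: power_mult_distrib power2_eq_square power3_eq_cube power4_eq_xxxx mult_ac)
  qed
  have 3: "wz_G q (Suc k) j = - C / S * ((1-q^3*S^2*t^4)*(1-q*S*t)*(1-q*S^2*t^2)^3*(1-q*S^2*t^3)*(1-q^2*t))"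
  proof -
    have e: "q powi (int (\<Sum>{..Suc k}) + int j * (int j - 1) - 2 * int j * int (Suc k) + 2 + 4 * int j - 3 * int (Suc k)) = e / S"
      unfolding e_def S_def by (subst power_int_diff[symmetric]) (auto simp: algebra_simps)
    have P: "qpoch q q (2 * j + Suc k) = P * (1-q*S^2*t^3)"
      using pkj by (simp add: P_def qpoch_Suc power2_eq_square mult_ac)
    have R: "rqpoch q (2 * int j + 2 - int (Suc k)) = (1 - q^2 * t) * R" "rqpoch (q^2) (int (Suc k) - int j - 1) = R2"
      using r2 by (simp_all add: R2_def algebra_simps)
    have q: "qpoch q q (Suc k) = qfk * (1 - q * S * t)"
        "qpoch (q^2) (q^2) (Suc k) = qek * (1 - q^2*S^2*t^2)"
        "qpoch q (q^2) (Suc k) = qok * (1 - q*S^2*t^2)"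
      using pk by (simp_all add: defs qpoch_Suc mult_ac)
    have nz2: "1 - q * S * t \<noteq> 0" "1 - q^2*S^2*t^2 \<noteq> 0"
      using q qpoch_nonzero(1,3)[of "Suc k"] by auto
    have x: "q ^ Suc k = q * S * t" "q ^ (2 * Suc k) = q^2*S^2*t^2"
      using pk by (simp_all add: power2_eq_square mult_ac)
    have O: "qpoch q (q^2) (j + Suc k + 1) = O2"
      by (simp add: O2_def)
    show ?thesis
      unfolding wz_G_def pj e P R O x q
      unfolding defs(4,5)[symmetric] qoj1_def[symmetric]
      unfolding C_def
      using nzs O2(2) qoj1(2) nz nz2 by (simp add: divide_simps) (simp add: power_mult_distrib power2_eq_square power3_eq_cube mult_ac)
  qed
  have 4: "wz_G q k j = C / S * (q^2*t*(1-S*t)^3*(1-S^2*t^2)*(1-S)*(1-q^3*S^2*t^4)*(1-q^3*S^3*t^4))"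
  proof -
    have e: "q powi (int (\<Sum>{..k}) + int j * (int j - 1) - 2 * int j * int k + 2 + 4 * int j - 3 * int k) = e * q^2 * t / S"
    proof -
      define i where "i = int (\<Sum>{..k}) + int j * (int j - 1) - 2 * int j * int k"
      have "q powi (i + 2 + a - b) = q powi i * q^2 * q powi a / q powi b" for a b
        by (simp add: power_int_add power_int_diff)
      from this[of "2 * int j - int k" "2 * (int k - int j)"] show ?thesis
        unfolding e_def S_def t_def i_def by (simp add: algebra_simps)
    qed
    have "1 - q^3 * S^3 * t^4 \<noteq> 0"
      using O2 by auto
    then show ?thesis
      unfolding wz_G_def pj pk e r3
      unfolding defs[symmetric] qoj1_def[symmetric] O1_def[symmetric] P_def[symmetric] R_def[symmetric]
      unfolding C_def O2(1)
      using nzs qoj1(2) nz by (simp add: divide_simps)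
  qed
  have lin: "- C / S * X - C * Y = C / S * (- X - S * Y)" "C / S * (- X - Y) = - C / S * X - C / S * Y" for X Y
    using nz by (simp_all add: field_simps)
  have "wz_A q k (Suc j) - wz_A q k j = C / S *
    (-((1-q*S^3*t^3)*(1-q*S^2*t^3)*(1-q^2*S^2*t^3)*(1-q^2*S*t^2)^3*(1-S)) - S*((1-q*S^3*t^3)*(1-q*t)*(1-q^2*t)*(1-q^3*S^3*t^4)*(1-q*S*t^2)^3))"
    unfolding 1 2 by (rule lin(1))
  also have "\<dots> = wz_G q (Suc k) j - wz_G q k j"
    unfolding 3 4 wzid by (rule lin(2))
  finally show ?thesis .
qed

text \<open>The same reduction as for \<open>wz_A_step\<close>, with x = q^k and Y = q^(2*j). Here
  \<open>C\<close> also contains 1/q, which clears the factor 1 - t/q arising when the index of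
  \<open>rqpoch q\<close> drops by two, and 1/D from the denominator of \<open>wz_H\<close>.\<close>

lemma wz_B_step:
  "wz_B q (Suc k) j - wz_B q k j = wz_H q k (Suc j) - wz_H q k j"
proof -
  define S where "S = q powi (2 * (int k - int j))"
  define t where "t = q powi (2 * int j - int k)"
  define x Y where xY: "x = S * t" "Y = S * t * t"
  have nz: "S \<noteq> 0" "t \<noteq> 0"
    by (auto simp: S_def t_def)
  have "q powi int k = S * t"
    unfolding S_def t_def by (subst power_int_add[symmetric]) auto
  then have x: "q ^ k = x"
    by (simp add: xY)
  have "q powi int (2 * j) = S * (t * t)"
    unfolding S_def t_def by (simp only: q_nonzero simp_thms power_int_add[symmetric] disj_not1) auto
  then have y: "q ^ (2 * j) = Y"
    by (simp add: xY mult.assoc del: of_nat_mult)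
  have pk: "(q^2) ^ k = x^2" "q ^ (2*k+2) = q^2 * x^2" "q ^ (3*k+3) = q^3 * x^3" "q ^ (k+1) = q * x"
    unfolding x[symmetric] by (simp_all add: power_add power2_eq_square power3_eq_cube power_mult_distrib power_mult mult.commute[of _ k]) 
  have pj: "(q^2) ^ j = Y" "q ^ (4*j+1) = q * Y^2" "q ^ (2 * Suc j) = q^2 * Y"
  proof -
    show "(q^2) ^ j = Y" "q ^ (2 * Suc j) = q^2 * Y"
      using y by (simp_all add: power_mult power2_eq_square)
    show "q ^ (4*j+1) = q * Y^2"
      unfolding y[symmetric] by (simp add: ac_simps flip: power_mult)
  qed
  have pkj: "q ^ (2*j+k) = x * Y" "(q^2) ^ (j+k) = x^2 * Y"
    using x y pk pj by (simp_all add: power_add)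
  have wzid: "q*(-(q^2*S*(1-q*Y^2)*(1-q*Y*x)*(1-t))-(1-q*Y^2)*(1-q^2*S)*(1-q^3*x^2*Y))*(1-q^2*x^2)*(1-q*x)
     = -(q*(1-q*x*Y)*(1-q^2*x*Y)*(1-q*Y)*(1-q^2*S)*(1-q^3*x^3))-(1-t)*(q-t)*(1-q^3*x^2*Y)*(1-Y)*(1-q^3*x^3)*q^2*S"
    unfolding xY by algebra
  define i where "i = int (\<Sum>{..k}) + int j * (int j - 1) - 2 * int j * int k"
  define e where "e = q powi i"
  define T where "T = q ^ (\<Sum>{..k})"
  define P where "P = qpoch q q (2 * j + k)"
  define R where "R = rqpoch q (2 * int j - int k)"
  define R2 where "R2 = rqpoch (q^2) (int k + 1 - int j)"
  define O1 where "O1 = qpoch q (q^2) (j + k + 1)"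
  define qoj qej where defs: "qoj = qpoch q (q^2) j" "qej = qpoch (q^2) (q^2) j"
  have nzs: "O1 \<noteq> 0" "qoj \<noteq> 0" "qej \<noteq> 0"
    by (simp_all add: O1_def defs)
  define O2 where "O2 = qpoch q (q^2) (Suc (j + k + 1))"
  have O2: "O2 = O1 * (1 - q^3 * x^2 * Y)" "O2 \<noteq> 0"
  proof -
    show "O2 \<noteq> 0"
      unfolding O2_def by (rule qpoch_nonzero)
    show "O2 = O1 * (1 - q^3 * x^2 * Y)"
      unfolding O2_def O1_def qpoch_Suc[of _ _ "j + k + 1"] using pkj by (simp add: power2_eq_square power3_eq_cube mult_ac)
  qed
  define D where "D = (1 - q^2 * x^2) * (1 - q * x)"
  have D: "1 - q^2 * x^2 \<noteq> 0" "1 - q * x \<noteq> 0" "D \<noteq> 0"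
    using factor_nonzero[of "2*k+2"] factor_nonzero[of "k+1"] pk by (auto simp: D_def)
  have t1: "q powi (2 * int j - int k - 1) = t / q"
    by (simp add: t_def power_int_diff)
  have r1: "rqpoch q (2 * int j - int k - 1) = (1 - t) * R"
    unfolding t_def R_def by (rule rqpoch_steps(1)) simp
  have r2: "rqpoch q (2 * int j - int k - 2) = (1 - t / q) * ((1 - t) * R)"
    unfolding t1[symmetric] r1[symmetric] by (rule rqpoch_steps(1)) simp
  have S1: "q powi (2 * (int k + 1 - int j)) = q^2 * S"
    using power_int_add[of q 2 "2 * (int k - int j)"] by (simp add: S_def algebra_simps)
  have r3: "rqpoch (q^2) (int k - int j) = (1 - q^2 * S) * R2"
    unfolding S1[symmetric] R2_def by (rule rqpoch_steps(2)) simp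
  define C where "C = (-1) ^ (k+j) * T * e * P * qoj * R * R2 / (O2 * qej * q * D)"
  have 1: "wz_B q (Suc k) j = - C * (q*(q^2*S*(1-q*Y^2)*(1-q*Y*x)*(1-t))*(1-q^2*x^2)*(1-q*x))"
  proof -
    have "q powi (i + (int k + 1) - 2 * int j) = e * q powi (int k + 1) / q powi (2 * int j)"
      by (simp add: power_int_add power_int_diff e_def)
    moreover have "q powi (int k + 1) = q * x" "q powi (2 * int j) = Y"
      using x \<open>q powi int (2 * j) = S * (t * t)\<close> by (simp_all add: power_int_add xY)
    ultimately have e: "q powi (int (\<Sum>{..Suc k}) + int j * (int j - 1) - 2 * int j * int (Suc k)) = e * (q * x) / Y"
      by (simp add: i_def algebra_simps)
    have P: "qpoch q q (2 * j + Suc k) = P * (1-q*Y*x)"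
      using pkj by (simp add: P_def qpoch_Suc mult_ac)
    have R: "rqpoch q (2 * int j - int (Suc k)) = (1 - t) * R" "rqpoch (q^2) (int (Suc k) - int j) = R2"
      using r1 by (simp_all add: R2_def algebra_simps)
    have T: "q ^ (\<Sum>{..Suc k}) = T * q * x"
      using x by (simp add: T_def power_add mult_ac)
    have O: "qpoch q (q^2) (j + Suc k + 1) = O2"
      by (simp add: O2_def)
    show ?thesis
      unfolding wz_B_def wz_coeff_def pj e P R O T
      unfolding defs[symmetric]
      unfolding C_def D_def
      using nzs O2(2) D nz q_nonzero by (simp add: divide_simps xY) (simp add: power2_eq_square mult_ac)
  qed
  have 2: "wz_B q k j = C * (q*((1-q*Y^2)*(1-q^2*S)*(1-q^3*x^2*Y))*(1-q^2*x^2)*(1-q*x))"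
  proof -
    have "1 - q^3 * x^2 * Y \<noteq> 0"
      using O2 by auto
    then show ?thesis
      unfolding wz_B_def wz_coeff_def pj r3
      unfolding defs[symmetric] e_def[unfolded i_def, symmetric] P_def[symmetric] R_def[symmetric] O1_def[symmetric] T_def[symmetric]
      unfolding C_def D_def O2(1)
      using nzs D q_nonzero by (simp add: divide_simps)
  qed
  have 3: "wz_H q k (Suc j) = - C * (q*(1-q*x*Y)*(1-q^2*x*Y)*(1-q*Y)*(1-q^2*S)*(1-q^3*x^3))"
  proof -
    have e: "q powi (int (\<Sum>{..k}) + int (Suc j) * (int (Suc j) - 1) - 2 * int (Suc j) * int k + 2 + 2 * int k - 2 * int (Suc j)) = e"
      unfolding e_def i_def by (simp add: algebra_simps)
    have P: "qpoch q q (2 * Suc j + k) = P * (1-q*x*Y) * (1-q^2*x*Y)"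
      using pkj by (simp add: P_def qpoch_Suc power2_eq_square mult_ac)
    have R: "rqpoch q (2 * int (Suc j) - int k - 2) = R" "rqpoch (q^2) (int k + 1 - int (Suc j)) = (1 - q^2 * S) * R2"
      using r3 by (simp_all add: R_def)
    have q: "qpoch q (q^2) (Suc j) = qoj * (1 - q * Y)" "qpoch (q^2) (q^2) (Suc j) = qej * (1 - q^2 * Y)"
      using pj by (simp_all add: defs qpoch_Suc mult_ac)
    have q': "1 - q^2 * Y \<noteq> 0"
      using qpoch_nonzero(3)[of "Suc j"] q by auto
    have O: "qpoch q (q^2) (Suc j + k + 1) = O2"
      by (simp add: O2_def)
    show ?thesis
      unfolding wz_H_def pj pk e P R O q
      unfolding T_def[symmetric]
      unfolding C_def D_def
      using nzs O2(2) D q' nz q_nonzero by (simp add: divide_simps)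
  qed
  have 4: "wz_H q k j = C * ((1-t)*(q-t)*(1-q^3*x^2*Y)*(1-Y)*(1-q^3*x^3)*q^2*S)"
  proof -
    have "q powi (i + 2 + a) = e * q^2 * q powi a" for a
      by (simp add: power_int_add e_def)
    from this[of "2 * (int k - int j)"]
    have e: "q powi (int (\<Sum>{..k}) + int j * (int j - 1) - 2 * int j * int k + 2 + 2 * int k - 2 * int j) = e * q^2 * S"
      unfolding S_def i_def by (simp add: algebra_simps)
    have "1 - q^3 * x^2 * Y \<noteq> 0"
      using O2 by auto
    then show ?thesis
      unfolding wz_H_def pk y e r2
      unfolding defs[symmetric] P_def[symmetric] R2_def[symmetric] O1_def[symmetric] T_def[symmetric]
      unfolding C_def D_def O2(1)
      using nzs D q_nonzero by (simp add: divide_simps)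
  qed
  have lin: "- C * (q * A * a * b) - C * (q * B * a * b) = C * (q * (- A - B) * a * b)"
    "C * (- A - B) = - C * A - C * B" for A B a b
    by (simp_all add: algebra_simps)
  show ?thesis
    unfolding 1 2 3 4 lin(1) wzid lin(2) ..
qed

section \<open>Summation of the WZ equations by telescoping\<close>

lemma wz_A_zero: "j > k \<Longrightarrow> wz_A q k j = 0"
  and wz_coeff_zero: "j > k \<Longrightarrow> wz_coeff q k j = 0"
  by (simp_all add: wz_A_def wz_coeff_def rqpoch_def)

text \<open>Summing the WZ equation over \<open>j\<close> shows that the sum does not depend on
  \<open>k\<close>; for \<open>k = 0\<close> it is a single term.\<close>

lemma wz_B_sum: "(\<Sum>j\<le>k. wz_B q k j) = 1"
proof (induction k)
  case 0
  have "1 - q \<noteq> 0"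
    using q_not_root[of 1] by auto
  then show ?case
    by (simp add: wz_B_def wz_coeff_def rqpoch_def qpoch_def)
next
  case (Suc k)
  have "(\<Sum>j<Suc (Suc k). wz_B q (Suc k) j) - (\<Sum>j<Suc (Suc k). wz_B q k j)
      = (\<Sum>j<Suc (Suc k). wz_H q k (Suc j) - wz_H q k j)"
    by (simp only: sum_subtractf[symmetric] wz_B_step)
  also have "\<dots> = wz_H q k (Suc (Suc k)) - wz_H q k 0"
    by (rule sum_lessThan_telescope)
  \<comment> \<open>At j = 0 the factor 1 - q^(2*j) vanishes, and at j = k + 2 a reciprocal
    q-factorial has index -1.\<close>
  also have "\<dots> = 0"
    by (simp add: wz_H_def rqpoch_def)
  finally show ?case
    using Suc by (simp add: lessThan_Suc_atMost wz_B_def wz_coeff_zero)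
qed

lemma wz_A_sum_step:
  "(\<Sum>k<K. wz_A q k (Suc j)) - (\<Sum>k<K. wz_A q k j) = wz_G q K j"
proof -
  have "(\<Sum>k<K. wz_A q k (Suc j)) - (\<Sum>k<K. wz_A q k j) = (\<Sum>k<K. wz_G q (Suc k) j - wz_G q k j)"
    by (simp only: sum_subtractf[symmetric] wz_A_step)
  also have "\<dots> = wz_G q K j - wz_G q 0 j"
    by (rule sum_lessThan_telescope)
  also have "wz_G q 0 j = 0"
    by (simp add: wz_G_def)
  finally show ?thesis
    by simp
qed

text \<open>A step from \<open>j\<close> to \<open>Suc j\<close> adds \<open>wz_G q K j\<close>,
  which contains a reciprocal q-factorial of negative index 2*j + 2 - K. So the sum is the one for j
  = 0, where only k = 0 contributes.\<close>

lemma wz_A_sum: "2 * j < K \<Longrightarrow> (\<Sum>k<K. wz_A q k j) = 1"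
proof (induction j)
  case 0
  have "wz_A q k 0 = (if k = 0 then 1 else 0)" for k
    using q_not_root[of 1]
    by (auto simp: wz_A_def wz_coeff_def rqpoch_def qpoch_def lhs_weight_def rhs_root_def)
  with 0 show ?case
    by simp
next
  case (Suc j)
  then have "wz_G q K j = 0"
    by (simp add: wz_G_def rqpoch_def)
  with Suc wz_A_sum_step[where K = K and j = j] show ?case
    by simp
qed

text \<open>The power of q is expanded by \<open>wz_B_sum\<close> and the two sums are exchanged.
  The inner sum of \<open>wz_A\<close> is the v_j of the introduction.\<close>

lemma lhs_expansion:
  "(\<Sum>k<n. (1 - q ^ (3*k+1)) * lhs_weight q k / q ^ (\<Sum>{..k}))
     = (\<Sum>j<n. (1 - q ^ (4*j+1)) * rhs_root q j ^ 4 * (\<Sum>k<n. wz_A q k j))"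
proof -
  have "1 / q ^ (\<Sum>{..k}) = (\<Sum>j<n. (1 - q ^ (4*j+1)) * wz_coeff q k j)" if "k < n" for k
  proof -
    have "1 = (\<Sum>j<n. wz_B q k j)"
      unfolding wz_B_sum[of k, symmetric] using that
      by (intro sum.mono_neutral_left) (auto simp: wz_B_def wz_coeff_zero)
    also have "\<dots> = q ^ (\<Sum>{..k}) * (\<Sum>j<n. (1 - q ^ (4*j+1)) * wz_coeff q k j)"
      by (simp add: wz_B_def sum_distrib_left mult_ac)
    finally show ?thesis
      by (simp add: field_simps)
  qed
  then have "(\<Sum>k<n. (1 - q ^ (3*k+1)) * lhs_weight q k / q ^ (\<Sum>{..k}))
      = (\<Sum>k<n. (1 - q ^ (3*k+1)) * lhs_weight q k * (\<Sum>j<n. (1 - q ^ (4*j+1)) * wz_coeff q k j))"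
    by (intro sum.cong) (auto simp flip: times_divide_eq_right mult.assoc simp: divide_inverse)
  also have "\<dots> = (\<Sum>j<n. \<Sum>k<n. (1 - q ^ (3*k+1)) * lhs_weight q k * ((1 - q ^ (4*j+1)) * wz_coeff q k j))"
    by (simp only: sum_distrib_left, subst sum.swap, rule refl)
  also have "\<dots> = (\<Sum>j<n. (1 - q ^ (4*j+1)) * rhs_root q j ^ 4 * (\<Sum>k<n. wz_A q k j))"
    unfolding sum_distrib_left by (intro sum.cong refl) (simp add: wz_A_def)
  finally show ?thesis .
qed

end

subsection \<open>Behaviour at a primitive root of unity\<close>

text \<open>The reflection \<open>j \<mapsto> lo + hi - j\<close> changes the sign of every summand.\<close>

lemma reflected_sum_zero:
  fixes \<zeta> :: complex and t :: "nat \<Rightarrow> complex"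
  assumes "lo \<le> hi"
    and nz: "\<And>j. lo \<le> j \<Longrightarrow> j \<le> hi \<Longrightarrow> t j \<noteq> 0"
    and step: "\<And>j. lo \<le> j \<Longrightarrow> j < hi \<Longrightarrow> t (Suc j) * (1 - \<zeta> ^ (2*j+2)) = t j * (1 - \<zeta> ^ (2*j+1))"
    and factor: "\<And>j. lo \<le> j \<Longrightarrow> j < hi \<Longrightarrow> \<zeta> ^ (2*j+1) \<noteq> 1" "\<And>j. lo \<le> j \<Longrightarrow> j < hi \<Longrightarrow> \<zeta> ^ (2*j+2) \<noteq> 1"
    and root: "\<zeta> ^ (2*(lo+hi)+1) = 1"
  shows "(\<Sum>j=lo..hi. (1 - \<zeta> ^ (4*j+1)) * t j ^ 4) = 0"
proof -
  have \<zeta>0: "\<zeta> \<noteq> 0"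
    using root by (metis power_0_Suc Suc_eq_plus1 zero_neq_one)
  \<comment> \<open>The ratio \<open>s\<close> of reflected to original term turns out to be
    geometric with ratio \<zeta>. Since reflection is an involution, \<open>s hi * s lo = 1\<close>,
    and this determines \<open>s lo ^ 4\<close>.\<close>
  define s where "s j = t (lo + hi - j) / t j" for j
  have s_step: "s (Suc j) = \<zeta> * s j" if "lo \<le> j" "j < hi" for j
  proof -
    define j' where "j' = lo + hi - Suc j"
    have j': "lo \<le> j'" "j' < hi" "lo + hi - j = Suc j'" "lo + hi - Suc j = j'"
      using that by (auto simp: j'_def)
    define b where "b = \<zeta> ^ (2*j+1)"
    define a where "a = \<zeta> ^ (2*j'+2)"
    define c where "c = \<zeta> ^ (2*j'+1)"
    \<comment> \<open>Reflection pairs the exponents 2*j'+2 with 2*j+1 and 2*j'+1 with 2*j+2; each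
      pair adds up to 2*(lo+hi)+1.\<close>
    have ab: "a * b = 1" "c * (\<zeta> * b) = 1"
    proof -
      have e: "2*j'+2 + (2*j+1) = 2*(lo+hi)+1" "2*j'+1 + Suc (2*j+1) = 2*(lo+hi)+1"
        using that by (auto simp: j'_def)
      show "a * b = 1" "c * (\<zeta> * b) = 1"
        unfolding a_def b_def c_def power_Suc[symmetric] power_add[symmetric] e root by simp_all
    qed
    have "b \<noteq> 0" using \<zeta>0 by (simp add: b_def)
    have acb: "a = 1 / b" "c = 1 / (\<zeta> * b)"
      using ab \<open>b \<noteq> 0\<close> \<zeta>0 by (simp_all add: field_simps)
    have bd: "\<zeta> ^ (2*j+2) = \<zeta> * b"
      by (simp add: b_def)
    have ne: "1 - b \<noteq> 0" "1 - \<zeta> * b \<noteq> 0" "t j \<noteq> 0" "t (Suc j) \<noteq> 0" "1 - c \<noteq> 0"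
      using factor that nz[of j] nz[of "Suc j"] factor(1)[OF j'(1,2)] by (auto simp: b_def c_def)
    have 1: "t (Suc j) * (1 - \<zeta> * b) = t j * (1 - b)"
      using step[OF that] bd by (simp add: b_def)
    have 2: "t (Suc j') * (1 - a) = t j' * (1 - c)"
      using step[OF j'(1,2)] by (simp add: a_def c_def)
    have 3: "(1 - a) * (1 - \<zeta> * b) = \<zeta> * ((1 - c) * (1 - b))"
      unfolding acb using \<open>b \<noteq> 0\<close> \<zeta>0 by (simp add: field_simps)
    have "t j' * t j * ((1 - c) * (1 - b)) = (t (Suc j') * (1 - a)) * (t (Suc j) * (1 - \<zeta> * b))"
      unfolding 1 2 by (simp add: mult_ac)
    also have "\<dots> = t (Suc j') * t (Suc j) * ((1 - a) * (1 - \<zeta> * b))"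
      by (simp add: mult_ac)
    also have "\<dots> = \<zeta> * t (Suc j') * t (Suc j) * ((1 - c) * (1 - b))"
      unfolding 3 by (simp add: mult_ac)
    finally have "t j' * t j = \<zeta> * t (Suc j') * t (Suc j)"
      using ne by simp
    then show ?thesis
      unfolding s_def j' using ne by (simp add: field_simps)
  qed
  have s: "s (lo + i) = \<zeta> ^ i * s lo" if "i \<le> hi - lo" for i
    using that
  proof (induction i)
    case (Suc i)
    then show ?case using s_step[of "lo + i"] by simp
  qed simp
  have "s hi * s lo = 1"
    using nz[of lo] nz[of hi] \<open>lo \<le> hi\<close> by (simp add: s_def)
  with s[of "hi - lo"] \<open>lo \<le> hi\<close> have s2: "\<zeta> ^ (hi - lo) * s lo ^ 2 = 1"
    by (simp add: power2_eq_square mult_ac)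
  have "(\<zeta> ^ (hi - lo) * s lo ^ 2) ^ 2 = 1"
    using s2 by simp
  then have s4: "\<zeta> ^ (2*(hi - lo)) * s lo ^ 4 = 1"
    by (simp add: power_mult_distrib flip: power_mult add: mult_ac)
  define f where "f j = (1 - \<zeta> ^ (4*j+1)) * t j ^ 4" for j
  have f: "f (lo + hi - j) = - f j" if "lo \<le> j" "j \<le> hi" for j
  proof -
    define A where "A = \<zeta> ^ (4*j+1)"
    have "\<zeta> ^ (4*(lo+hi-j)+1) * A = (\<zeta> ^ (2*(lo+hi)+1)) ^ 2"
      unfolding A_def power_mult[symmetric] power_add[symmetric] using that
      by (intro arg_cong[of _ _ "(^) \<zeta>"]) auto
    then have A1: "\<zeta> ^ (4*(lo+hi-j)+1) * A = 1"
      using root by simp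
    have A0: "A \<noteq> 0"
      using \<zeta>0 by (simp add: A_def)
    have "t (lo + hi - j) = s j * t j"
      using nz[OF that] by (simp add: s_def)
    also have "s j = \<zeta> ^ (j - lo) * s lo"
      using s[of "j - lo"] that by simp
    finally have t: "t (lo + hi - j) ^ 4 = \<zeta> ^ (4*(j - lo)) * s lo ^ 4 * t j ^ 4"
      by (simp add: power_mult_distrib flip: power_mult add: mult_ac)
    have "\<zeta> ^ (4*(j - lo)) * (\<zeta> ^ (2*(hi-lo)) * \<zeta> ^ (2*(lo+hi)+1)) = A * \<zeta> ^ (4*(hi-lo))"
      unfolding A_def power_add[symmetric] using that
      by (intro arg_cong[of _ _ "(^) \<zeta>"]) auto
    also have "\<zeta> ^ (4*(hi-lo)) = \<zeta> ^ (2*(hi-lo)) * \<zeta> ^ (2*(hi-lo))"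
      by (simp flip: power_add)
    finally have "\<zeta> ^ (4*(j - lo)) * \<zeta> ^ (2*(hi-lo)) = (A * \<zeta> ^ (2*(hi-lo))) * \<zeta> ^ (2*(hi-lo))"
      unfolding root by simp
    then have "\<zeta> ^ (4*(j - lo)) = A * \<zeta> ^ (2*(hi-lo))"
      using \<zeta>0 by (subst (asm) mult_cancel_right) simp
    \<comment> \<open>So reflection multiplies \<open>t j ^ 4\<close> by A = \<zeta>^(4*j+1) while 1
      - A becomes 1 - 1/A, and A*(1 - 1/A) = -(1 - A).\<close>
    then have PA: "\<zeta> ^ (4*(j - lo)) * s lo ^ 4 = A"
      using s4 by (simp add: mult.assoc)
    have WA: "(1 - \<zeta> ^ (4*(lo+hi-j)+1)) * A = - (1 - A)"
      using A1 by (simp add: algebra_simps)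
    show ?thesis
      unfolding f_def t PA mult.assoc[symmetric] WA by (simp add: A_def algebra_simps)
  qed
  have "(\<Sum>j=lo..hi. f j) = (\<Sum>j=lo..hi. f (hi + lo - j))"
    by (rule sum.atLeastAtMost_rev)
  also have "\<dots> = - (\<Sum>j=lo..hi. f j)"
    unfolding sum_negf[symmetric] by (intro sum.cong) (auto simp: f add.commute[of hi])
  finally show ?thesis
    unfolding f_def by simp
qed

lemma (in generic_base) rhs_root_step:
  "rhs_root q (Suc j) * (1 - q ^ (2*j+2)) = rhs_root q j * (1 - q ^ (2*j+1))"
proof -
  have "1 - q ^ (2*j+2) \<noteq> 0"
    using factor_nonzero[of "2*j+2"] by simp
  moreover have "q ^ (2*j+2) = q\<^sup>2 * (q\<^sup>2) ^ j" "q ^ (2*j+1) = q * (q\<^sup>2) ^ j"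
    by (simp_all add: power_mult power2_eq_square mult.assoc)
  ultimately show ?thesis
    by (simp only: rhs_root_def qpoch_Suc) simp
qed

section \<open>Orders of vanishing at a root of unity of odd order\<close>

locale primitive_root =
  fixes \<zeta> :: complex and m n :: nat
  assumes n_eq: "n = 2 * m + 1" and m_pos: "m > 0"
    and root: "\<zeta> ^ i = 1 \<longleftrightarrow> n dvd i"
begin

lemma n_pos: "n > 0"
  using n_eq by simp

lemma root_pow [simp]: "\<zeta> ^ n = 1"
  using root by simp

text \<open>The point \<open>\<zeta>\<close> is approached from outside the unit circle, because the WZ identities need \<open>q\<close> not
  to be a root of unity.\<close>

definition radial :: "complex filter" where
  "radial = filtermap (\<lambda>s. of_real s * \<zeta>) (at_right 1)"

lemma radial_nontrivial: "radial \<noteq> bot"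
  by (simp add: radial_def filtermap_bot_iff)

lemma tendsto_radial: "((\<lambda>q. q) \<longlongrightarrow> \<zeta>) radial"
proof -
  have "((\<lambda>s. of_real s * \<zeta>) \<longlongrightarrow> of_real 1 * \<zeta>) (at_right 1)"
    by (intro tendsto_intros)
  then show ?thesis
    by (simp add: radial_def filterlim_filtermap)
qed

lemma norm_root: "norm \<zeta> = 1"
proof -
  have "\<zeta> ^ n = 1"
    by simp
  then have "norm \<zeta> ^ n = 1"
    by (metis norm_one norm_power)
  then show ?thesis
    using power_eq_imp_eq_base[of "norm \<zeta>" n 1] n_pos by simp
qed

lemma root_nonzero [simp]: "\<zeta> \<noteq> 0"
  using norm_root by auto

lemma eventually_generic: "eventually generic_base radial"
  unfolding radial_def eventually_filtermap using eventually_at_right_less[of "1::real"]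
proof eventually_elim
  case (elim s)
  then have *: "norm (of_real s * \<zeta>) > 1"
    by (simp add: norm_mult norm_root)
  show ?case
  proof
    show "of_real s * \<zeta> \<noteq> 0"
      using * by auto
    show "(of_real s * \<zeta>) ^ i \<noteq> 1" if "i > 0" for i
      using power_gt1[OF *, of "i - 1"] that by (metis norm_one norm_power Suc_diff_1 less_irrefl)
  qed
qed

text \<open>The order of the zero of \<open>f\<close> at \<zeta>, negative for a pole, measured
  along \<open>radial\<close> against 1 - q^n, which has a simple zero there.\<close>

definition has_order :: "(complex \<Rightarrow> complex) \<Rightarrow> int \<Rightarrow> bool" where
  "has_order f e \<longleftrightarrow> (\<exists>L. L \<noteq> 0 \<and> ((\<lambda>q. f q / (1 - q ^ n) powi e) \<longlongrightarrow> L) radial)"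

lemma eventually_nz: "eventually (\<lambda>q. q \<noteq> 0 \<and> 1 - q ^ n \<noteq> 0) radial"
  using eventually_generic
  by eventually_elim (use generic_base.factor_nonzero generic_base.q_nonzero n_pos in blast)

lemma has_order_mult:
  assumes "has_order f a" "has_order g b"
  shows "has_order (\<lambda>q. f q * g q) (a + b)"
proof -
  obtain L M where L: "L \<noteq> 0" "((\<lambda>q. f q / (1 - q ^ n) powi a) \<longlongrightarrow> L) radial"
    and M: "M \<noteq> 0" "((\<lambda>q. g q / (1 - q ^ n) powi b) \<longlongrightarrow> M) radial"
    using assms by (auto simp: has_order_def)
  have "((\<lambda>q. (f q / (1 - q ^ n) powi a) * (g q / (1 - q ^ n) powi b)) \<longlongrightarrow> L * M) radial"
    by (intro tendsto_mult L M)
  then have "((\<lambda>q. f q * g q / (1 - q ^ n) powi (a + b)) \<longlongrightarrow> L * M) radial"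
    by (rule Lim_transform_eventually)
      (use eventually_nz in eventually_elim, simp add: power_int_add)
  then show ?thesis
    using L M by (auto simp: has_order_def intro!: exI[of _ "L * M"])
qed

lemma has_order_inverse:
  assumes "has_order f a"
  shows "has_order (\<lambda>q. inverse (f q)) (- a)"
proof -
  obtain L where L: "L \<noteq> 0" "((\<lambda>q. f q / (1 - q ^ n) powi a) \<longlongrightarrow> L) radial"
    using assms by (auto simp: has_order_def)
  have "((\<lambda>q. inverse (f q / (1 - q ^ n) powi a)) \<longlongrightarrow> inverse L) radial"
    by (intro tendsto_inverse L)
  then have "((\<lambda>q. inverse (f q) / (1 - q ^ n) powi (- a)) \<longlongrightarrow> inverse L) radial"
    by (simp add: power_int_minus field_simps)
  then show ?thesis
    using L by (auto simp: has_order_def intro!: exI[of _ "inverse L"])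
qed

lemma has_order_divide:
  "has_order f a \<Longrightarrow> has_order g b \<Longrightarrow> has_order (\<lambda>q. f q / g q) (a - b)"
  using has_order_mult[OF _ has_order_inverse, of f a g b] by (simp add: divide_inverse)

lemma has_order_0: "(f \<longlongrightarrow> L) radial \<Longrightarrow> L \<noteq> 0 \<Longrightarrow> has_order f 0"
  by (auto simp: has_order_def)

lemma has_order_const: "c \<noteq> 0 \<Longrightarrow> has_order (\<lambda>q. c) 0"
  by (rule has_order_0) (rule tendsto_const)

lemma has_order_power: "has_order f a \<Longrightarrow> has_order (\<lambda>q. f q ^ k) (int k * a)"
proof (induction k)
  case (Suc k)
  then show ?case
    using has_order_mult[of f a "\<lambda>q. f q ^ k" "int k * a"] by (simp add: algebra_simps)
qed (simp add: has_order_const)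

lemma has_order_powi: "has_order (\<lambda>q. q powi e) 0"
  by (rule has_order_0[where L = "\<zeta> powi e"])
    (auto intro!: tendsto_power_int tendsto_radial)

lemma has_order_factor:
  assumes "i > 0"
  shows "has_order (\<lambda>q. 1 - q ^ i) (of_bool (n dvd i))"
proof (cases "n dvd i")
  case True
  then obtain l where l: "i = n * l"
    by blast
  have "((\<lambda>q. \<Sum>s<l. (q ^ n) ^ s) \<longlongrightarrow> (\<Sum>s<l. (\<zeta> ^ n) ^ s)) radial"
    by (intro tendsto_intros tendsto_radial)
  also have "(\<Sum>s<l. (\<zeta> ^ n) ^ s) = of_nat l"
    by simp
  finally have "((\<lambda>q. (1 - q ^ i) / (1 - q ^ n) powi 1) \<longlongrightarrow> of_nat l) radial"
    by (rule Lim_transform_eventually)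
      (use eventually_nz in eventually_elim, simp add: l power_mult sum_gp_strict)
  then show ?thesis
    using True l assms by (auto simp: has_order_def intro!: exI[of _ "of_nat l"])
next
  case False
  have "((\<lambda>q. 1 - q ^ i) \<longlongrightarrow> 1 - \<zeta> ^ i) radial"
    by (intro tendsto_intros tendsto_radial)
  then show ?thesis
    using False root[of i] by (intro has_order_0[THEN back_subst[of "has_order _"]]) auto
qed

lemma has_order_tendsto_0:
  assumes "has_order f a" "a > 0"
  shows "(f \<longlongrightarrow> 0) radial"
proof -
  obtain L where L: "L \<noteq> 0" "((\<lambda>q. f q / (1 - q ^ n) powi a) \<longlongrightarrow> L) radial"
    using assms by (auto simp: has_order_def)
  have "((\<lambda>q. (f q / (1 - q ^ n) powi a) * (1 - q ^ n) ^ nat a) \<longlongrightarrow> L * (1 - \<zeta> ^ n) ^ nat a) radial"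
    by (intro tendsto_intros L tendsto_radial)
  then have "((\<lambda>q. (f q / (1 - q ^ n) powi a) * (1 - q ^ n) ^ nat a) \<longlongrightarrow> 0) radial"
    using assms by (simp add: zero_power)
  then show ?thesis
    by (rule Lim_transform_eventually)
      (use eventually_nz in eventually_elim, use assms in \<open>simp add: power_int_def\<close>)
qed

lemma has_order_convergent:
  assumes "has_order f a" "a \<ge> 0"
  obtains l where "(f \<longlongrightarrow> l) radial"
proof (cases "a = 0")
  case True
  then show ?thesis
    using assms that by (auto simp: has_order_def)
next
  case False
  then show ?thesis
    using assms that has_order_tendsto_0[of f a] by auto
qed

text \<open>Each order counts the multiples of \<open>n\<close> among the exponents. For (q;q^2)_k
  these are 2*i+1, and 2*(i+m+1) = 2*i+1+n with \<open>n\<close> odd shows that \<open>n\<close>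
  divides 2*i+1 exactly when it divides i+m+1; hence the shift by \<open>m\<close>.\<close>

lemma has_order_qpoch:
  "has_order (\<lambda>q. qpoch q q k) (int (k div n))"
  "has_order (\<lambda>q. qpoch (q^2) (q^2) k) (int (k div n))"
  "has_order (\<lambda>q. qpoch q (q^2) k) (int ((k + m) div n))"
proof -
  have div: "int (Suc k div n) = int (k div n) + of_bool (n dvd Suc k)" for k
    by (simp add: div_Suc dvd_eq_mod_eq_0)
  have cop: "coprime n 2"
    unfolding n_eq by simp
  show "has_order (\<lambda>q. qpoch q q k) (int (k div n))"
  proof (induction k)
    case (Suc k)
    then show ?case
      using has_order_mult[OF Suc has_order_factor[of "Suc k"]] unfolding div by (simp add: qpoch_Suc)
  qed (simp add: has_order_const)
  show "has_order (\<lambda>q. qpoch (q^2) (q^2) k) (int (k div n))"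
  proof (induction k)
    case (Suc k)
    have "n dvd 2 * Suc k \<longleftrightarrow> n dvd Suc k"
      using cop by (simp add: coprime_dvd_mult_right_iff del: mult_Suc_right)
    then show ?case
      using has_order_mult[OF Suc has_order_factor[of "2 * Suc k"]] unfolding div
      by (simp add: qpoch_Suc power_mult power2_eq_square mult.assoc)
  qed (simp add: has_order_const)
  show "has_order (\<lambda>q. qpoch q (q^2) k) (int ((k + m) div n))"
  proof (induction k)
    case 0
    have "m div n = 0"
      using n_eq by simp
    then show ?case
      by (simp add: has_order_const)
  next
    case (Suc k)
    have "n dvd Suc (k + m) \<longleftrightarrow> n dvd 2 * Suc (k + m)"
      using cop by (simp add: coprime_dvd_mult_right_iff del: mult_Suc_right)
    also have "2 * Suc (k + m) = (2 * k + 1) + n"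
      by (simp add: n_eq)
    also have "n dvd \<dots> \<longleftrightarrow> n dvd 2 * k + 1"
      by (rule dvd_add_left_iff) simp
    finally show ?case
      using has_order_mult[OF Suc has_order_factor[of "2 * k + 1"]] div[of "k + m"]
      by (simp add: qpoch_Suc power_mult)
  qed
qed

lemma has_order_rqpoch:
  assumes "i \<ge> 0" "i < int n"
  shows "has_order (\<lambda>q. rqpoch q i) 0" "has_order (\<lambda>q. rqpoch (q^2) i) 0"
proof -
  have "nat i div n = 0"
    using assms by simp
  then show "has_order (\<lambda>q. rqpoch q i) 0" "has_order (\<lambda>q. rqpoch (q^2) i) 0"
    using has_order_inverse[OF has_order_qpoch(1)[of "nat i"]] has_order_inverse[OF has_order_qpoch(2)[of "nat i"]] assms
    by (simp_all add: rqpoch_def)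
qed

lemma has_order_lhs_weight:
  "has_order (\<lambda>q. lhs_weight q k) (3 * int ((k + m) div n) - 3 * int (k div n))"
proof -
  have "has_order (\<lambda>q. lhs_weight q k)
      (int 3 * int ((k + m) div n) - (int 2 * int (k div n) + int (k div n)))"
    unfolding lhs_weight_def
    by (intro has_order_divide has_order_power has_order_mult has_order_qpoch)
  then show ?thesis
    by (simp add: algebra_simps)
qed

lemma has_order_rhs_root:
  "has_order (\<lambda>q. rhs_root q j) (int ((j + m) div n) - int (j div n))"
  unfolding rhs_root_def by (intro has_order_divide has_order_qpoch)

text \<open>For j \<le> k, \<open>lhs_weight\<close> contributes order 3, the division by
  \<open>rhs_root q j ^ 4\<close> order -4, and \<open>wz_coeff\<close> at least 1, so there is no
  pole. For k < j the term is zero.\<close>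

lemma wz_A_convergent:
  assumes j: "m < j" "j < n" and k: "k < n"
  obtains l where "((\<lambda>q. wz_A q k j) \<longlongrightarrow> l) radial"
proof (cases "k < j")
  case True
  have "((\<lambda>q. wz_A q k j) \<longlongrightarrow> 0) radial"
    by (rule tendsto_eventually, use eventually_generic in eventually_elim)
      (use True in \<open>simp add: generic_base.wz_A_zero\<close>)
  then show ?thesis
    by (rule that)
next
  case False
  define a b where ab: "a = int ((2 * j + k) div n)" "b = int ((j + k + 1 + m) div n)"
  have div: "(k + m) div n = 1" "k div n = 0" "(j + m) div n = 1" "j div n = 0"
    using assms False by (auto simp: n_eq div_nat_eqI)
  have "has_order (\<lambda>q. wz_coeff q k j) (0 + 0 + a + int ((j + m) div n) + 0 + 0 - (b + int (j div n)))"
    unfolding wz_coeff_def ab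
    using assms False n_eq
    by (intro has_order_divide has_order_mult has_order_qpoch has_order_rqpoch has_order_powi has_order_const) auto
  then have "has_order (\<lambda>q. wz_coeff q k j) (a + 1 - b)"
    by (simp add: div)
  moreover have "has_order (\<lambda>q. lhs_weight q k) 3" "has_order (\<lambda>q. rhs_root q j) 1"
    using has_order_lhs_weight[of k] has_order_rhs_root[of j] by (simp_all add: div)
  ultimately have A: "has_order (\<lambda>q. wz_A q k j) (of_bool (n dvd 3*k+1) + 3 + (a + 1 - b) - int 4 * 1)"
    unfolding wz_A_def
    by (intro has_order_divide has_order_mult has_order_power has_order_factor) auto
  \<comment> \<open>From j > m one gets j + k + 1 + m \<le> 2*j + k: the order of (q;q)_(2*j+k) is
    at least that of (q;q^2)_(j+k+1).\<close>
  have "b \<le> a"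
    unfolding ab using j by (auto intro!: div_le_mono)
  have "0 \<le> of_bool (n dvd 3*k+1) + 3 + (a + 1 - b) - int 4 * 1"
    using \<open>b \<le> a\<close> by simp
  with A obtain l where "((\<lambda>q. wz_A q k j) \<longlongrightarrow> l) radial"
    by (rule has_order_convergent)
  then show ?thesis
    by (rule that)
qed

text \<open>The numerator has order at least 3 + 1 + 3 + 2 = 9, the denominator order 2 + 1 + 2 + 3
  = 8.\<close>

lemma wz_G_tendsto_0:
  assumes j: "m < j" "Suc j < n"
  shows "((\<lambda>q. wz_G q n j) \<longlongrightarrow> 0) radial"
proof -
  have div: "(n + m) div n = 1" "n div n = 1" "(2 * j + n) div n = 2" "j div n = 0"
      "(j + n + 1 + m) div n = 2" "(Suc j + m) div n = 1"
    using assms by (auto simp: n_eq div_nat_eqI)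
  have "has_order (\<lambda>q. wz_G q n j)
      (0 + 0 + of_bool (n dvd 4*j+3) + int 3 * of_bool (n dvd n) + of_bool (n dvd 2*n)
        + int 3 * int ((n + m) div n) + int ((2 * j + n) div n) + int 3 * int (j div n) + 0 + 0
        - (int 2 * int (n div n) + int (n div n) + int ((j + n + 1 + m) div n) + int 3 * int ((Suc j + m) div n)))"
    unfolding wz_G_def
    using assms n_eq
    by (intro has_order_divide has_order_mult has_order_qpoch has_order_rqpoch has_order_powi
        has_order_const has_order_power has_order_factor) auto
  then show ?thesis
    by (rule has_order_tendsto_0) (simp only: div, simp)
qed

text \<open>Consecutive sums differ by \<open>wz_G q n j\<close>, which tends to 0, so all share the
  limit of the first one, at j = m + 1.\<close>

lemma truncated_sum_limit:
  obtains c where "\<And>j. m < j \<Longrightarrow> j < n \<Longrightarrow> ((\<lambda>q. \<Sum>k<n. wz_A q k j) \<longlongrightarrow> c) radial"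
proof -
  have "\<exists>l. ((\<lambda>q. wz_A q k (Suc m)) \<longlongrightarrow> l) radial" if "k < n" for k
    by (rule wz_A_convergent[of "Suc m" k]) (use that m_pos n_eq in auto)
  then obtain l where l: "\<And>k. k < n \<Longrightarrow> ((\<lambda>q. wz_A q k (Suc m)) \<longlongrightarrow> l k) radial"
    by metis
  define c where "c = (\<Sum>k<n. l k)"
  have base: "((\<lambda>q. \<Sum>k<n. wz_A q k (Suc m)) \<longlongrightarrow> c) radial"
    unfolding c_def by (intro tendsto_sum l) auto
  have "((\<lambda>q. \<Sum>k<n. wz_A q k j) \<longlongrightarrow> c) radial" if "Suc m \<le> j" "j < n" for j
    using that
  proof (induction j rule: dec_induct)
    case base
    then show ?case
      using \<open>((\<lambda>q. \<Sum>k<n. wz_A q k (Suc m)) \<longlongrightarrow> c) radial\<close> by simp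
  next
    case (step j)
    have "((\<lambda>q. (\<Sum>k<n. wz_A q k j) + wz_G q n j) \<longlongrightarrow> c + 0) radial"
      using step by (intro tendsto_add wz_G_tendsto_0) auto
    then have "((\<lambda>q. \<Sum>k<n. wz_A q k (Suc j)) \<longlongrightarrow> c + 0) radial"
      by (rule Lim_transform_eventually)
        (use eventually_generic in eventually_elim, simp flip: generic_base.wz_A_sum_step)
    then show ?case
      by simp
  qed
  then show ?thesis
    using that by (auto simp: Suc_le_eq)
qed

text \<open>In \<open>lhs_expansion\<close> the terms with j \<le> m are those of the right-hand
  sum. From the others (1 - q^n)^4 splits off, and the rest tends to the common limit of the inner
  sums times a sum that vanishes by reflection.\<close>

lemma difference_tendsto_0:
  "((\<lambda>q. ((\<Sum>k<n. (1 - q ^ (3*k+1)) * lhs_weight q k / q ^ (\<Sum>{..k}))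
        - (\<Sum>j\<le>m. (1 - q ^ (4*j+1)) * rhs_root q j ^ 4)) / (1 - q ^ n) ^ 4) \<longlongrightarrow> 0) radial"
proof -
  obtain c where c: "\<And>j. m < j \<Longrightarrow> j < n \<Longrightarrow> ((\<lambda>q. \<Sum>k<n. wz_A q k j) \<longlongrightarrow> c) radial"
    using truncated_sum_limit by blast
  have "\<exists>L. L \<noteq> 0 \<and> ((\<lambda>q. rhs_root q j / (1 - q ^ n)) \<longlongrightarrow> L) radial" if "m < j" "j < n" for j
  proof -
    have "(j + m) div n = 1" "j div n = 0"
      using that by (auto simp: n_eq div_nat_eqI)
    then show ?thesis
      using has_order_rhs_root[of j] by (simp add: has_order_def)
  qed
  then obtain t where t0: "\<And>j. m < j \<Longrightarrow> j < n \<Longrightarrow> t j \<noteq> 0"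
    and t: "\<And>j. m < j \<Longrightarrow> j < n \<Longrightarrow> ((\<lambda>q. rhs_root q j / (1 - q ^ n)) \<longlongrightarrow> t j) radial"
    by metis
  \<comment> \<open>Both numbers lie strictly between n and 2*n.\<close>
  have ndvd: "\<not> n dvd 2*j+1" "\<not> n dvd 2*j+2" if "m < j" "Suc j < n" for j
  proof -
    have "(2*j+1) mod n = 2*j+1-n" "(2*j+2) mod n = 2*j+2-n"
      using that by (simp_all add: mod_if n_eq)
    then show "\<not> n dvd 2*j+1" "\<not> n dvd 2*j+2"
      using that n_eq by (auto simp: dvd_eq_mod_eq_0)
  qed
  have zero: "(\<Sum>j=Suc m..n-1. (1 - \<zeta> ^ (4*j+1)) * t j ^ 4) = 0"
  proof (rule reflected_sum_zero)
    show "Suc m \<le> n - 1"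
      using m_pos n_eq by simp
    show "t j \<noteq> 0" if "Suc m \<le> j" "j \<le> n - 1" for j
      using that t0[of j] n_pos by simp
    show "\<zeta> ^ (2*j+1) \<noteq> 1" "\<zeta> ^ (2*j+2) \<noteq> 1" if "Suc m \<le> j" "j < n - 1" for j
      using that ndvd[of j] unfolding root by simp_all
    have "2 * (Suc m + (n - 1)) + 1 = n * 3"
      using n_eq by simp
    then have "\<zeta> ^ (2 * (Suc m + (n - 1)) + 1) = (\<zeta> ^ n) ^ 3"
      by (simp only: power_mult)
    then show "\<zeta> ^ (2 * (Suc m + (n - 1)) + 1) = 1"
      by simp
    show "t (Suc j) * (1 - \<zeta> ^ (2*j+2)) = t j * (1 - \<zeta> ^ (2*j+1))" if j: "Suc m \<le> j" "j < n - 1" for j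
    proof (rule tendsto_unique[OF radial_nontrivial])
      show "((\<lambda>q. rhs_root q j / (1 - q ^ n) * (1 - q ^ (2*j+1))) \<longlongrightarrow> t j * (1 - \<zeta> ^ (2*j+1))) radial"
        using j by (intro tendsto_intros t tendsto_radial) auto
      have "((\<lambda>q. rhs_root q (Suc j) / (1 - q ^ n) * (1 - q ^ (2*j+2))) \<longlongrightarrow> t (Suc j) * (1 - \<zeta> ^ (2*j+2))) radial"
        using j by (intro tendsto_intros t tendsto_radial) auto
      then show "((\<lambda>q. rhs_root q j / (1 - q ^ n) * (1 - q ^ (2*j+1))) \<longlongrightarrow> t (Suc j) * (1 - \<zeta> ^ (2*j+2))) radial"
      proof (rule Lim_transform_eventually, use eventually_generic in eventually_elim)
        case (elim q)
        show ?case
          using generic_base.rhs_root_step[OF elim, of j] by simp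
      qed
    qed
  qed
  have "((\<lambda>q. \<Sum>j=Suc m..n-1. (1 - q ^ (4*j+1)) * (rhs_root q j / (1 - q ^ n)) ^ 4 * (\<Sum>k<n. wz_A q k j))
      \<longlongrightarrow> (\<Sum>j=Suc m..n-1. (1 - \<zeta> ^ (4*j+1)) * t j ^ 4 * c)) radial"
    using n_pos by (intro tendsto_sum tendsto_mult tendsto_power tendsto_diff tendsto_const tendsto_radial t c) auto
  also have "(\<Sum>j=Suc m..n-1. (1 - \<zeta> ^ (4*j+1)) * t j ^ 4 * c) = 0"
    unfolding sum_distrib_right[symmetric] zero by simp
  finally show ?thesis
  proof (rule Lim_transform_eventually, use eventually_generic in eventually_elim)
    case (elim q)
    then interpret generic_base q .
    have "{..<n} = {..m} \<union> {Suc m..n-1}"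
      using n_eq by auto
    then have "(\<Sum>k<n. (1 - q ^ (3*k+1)) * lhs_weight q k / q ^ (\<Sum>{..k}))
        = (\<Sum>j\<le>m. (1 - q ^ (4*j+1)) * rhs_root q j ^ 4 * (\<Sum>k<n. wz_A q k j))
          + (\<Sum>j=Suc m..n-1. (1 - q ^ (4*j+1)) * rhs_root q j ^ 4 * (\<Sum>k<n. wz_A q k j))"
      unfolding lhs_expansion by (simp add: sum.union_disjoint)
    also have "(\<Sum>j\<le>m. (1 - q ^ (4*j+1)) * rhs_root q j ^ 4 * (\<Sum>k<n. wz_A q k j))
        = (\<Sum>j\<le>m. (1 - q ^ (4*j+1)) * rhs_root q j ^ 4)"
      by (intro sum.cong refl) (subst wz_A_sum, use n_eq in auto)
    finally show ?case
      by (simp add: power_divide sum_divide_distrib)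
  qed
qed

end

subsection \<open>Gaussian binomials and smaller roots of unity\<close>

text \<open>The q-Pascal rule makes these integer polynomials in q, which can be evaluated at roots
  of unity and at 1, where a quotient of q-factorials may degenerate to 0/0.\<close>

fun gbinom :: "'a::comm_ring_1 \<Rightarrow> nat \<Rightarrow> nat \<Rightarrow> 'a" where
  "gbinom q n 0 = 1"
| "gbinom q 0 (Suc k) = 0"
| "gbinom q (Suc n) (Suc k) = gbinom q n k + q ^ Suc k * gbinom q n (Suc k)"

lemma gbinom_eq_0: "n < k \<Longrightarrow> gbinom q n k = 0"
  by (induction q n k rule: gbinom.induct) auto

lemma gbinom_1: "gbinom (1::'a::comm_ring_1) n k = of_nat (n choose k)"
  by (induction "1::'a" n k rule: gbinom.induct) auto

lemma gbinom_qpoch: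
  "k \<le> n \<Longrightarrow> gbinom q n k * qpoch q q k * qpoch q q (n - k) = qpoch q q n"
proof (induction q n k rule: gbinom.induct)
  case (3 q n k)
  have rec: "qpoch q q (Suc k) = qpoch q q k * (1 - q ^ Suc k)" for k
    by (simp add: qpoch_Suc)
  show ?case
  proof (cases "k = n")
    case True
    then show ?thesis
      using 3 by (simp add: gbinom_eq_0 rec mult.assoc[symmetric] del: power_Suc)
  next
    case False
    define i where "i = n - Suc k"
    have i: "n - k = Suc i" "n - Suc k = i" "Suc n - Suc k = Suc i" "Suc k + Suc i = Suc n"
      using False 3 by (auto simp: i_def)
    have 1: "gbinom q n k * qpoch q q k * qpoch q q (Suc i) = qpoch q q n"
      and 2: "gbinom q n (Suc k) * qpoch q q (Suc k) * qpoch q q i = qpoch q q n"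
      using 3 False i by auto
    have "gbinom q (Suc n) (Suc k) * qpoch q q (Suc k) * qpoch q q (Suc i)
        = gbinom q n k * qpoch q q k * qpoch q q (Suc i) * (1 - q ^ Suc k)
          + q ^ Suc k * (gbinom q n (Suc k) * qpoch q q (Suc k) * qpoch q q i) * (1 - q ^ Suc i)"
      by (simp add: rec algebra_simps del: power_Suc)
    also have "\<dots> = qpoch q q n * (1 - q ^ (Suc k + Suc i))"
      unfolding 1 2 by (simp add: algebra_simps power_add)
    finally show ?thesis
      unfolding i rec[of n] .
  qed
qed auto

text \<open>\<open>lhs_term\<close> and \<open>rhs_term\<close> rewrite
  \<open>lhs_weight q k / q ^ (\<Sum>{..k})\<close> and \<open>rhs_root q k ^ 4\<close> so that only
  powers of q and of 1 + q^i remain in the denominators. None of these vanishes at a root of unity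
  of odd order, in particular at 1.\<close>

definition lhs_term :: "'a::field \<Rightarrow> nat \<Rightarrow> 'a" where
  "lhs_term q k = gbinom q (2*k) k ^ 3 / (qpoch (-q) q k ^ 4 * q ^ (\<Sum>{..k}))"

definition rhs_term :: "'a::field \<Rightarrow> nat \<Rightarrow> 'a" where
  "rhs_term q k = gbinom q (2*k) k ^ 4 / qpoch (-q) q k ^ 8"

lemma qpoch_square: "qpoch (q^2) (q^2) k = qpoch q q k * qpoch (-q) q k"
  by (induction k) (simp_all add: qpoch_Suc power2_eq_square algebra_simps power_mult_distrib)

lemma qpoch_double: "qpoch q q (2*k) = qpoch q (q^2) k * qpoch (q^2) (q^2) k"
  by (induction k) (simp_all add: qpoch_Suc power_mult power2_eq_square algebra_simps)

context generic_base
begin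

lemma qpoch_minus_nonzero [simp]: "qpoch (-q) q k \<noteq> 0"
  using qpoch_nonzero(3)[of k] unfolding qpoch_square by simp

lemma rhs_root_gbinom: "rhs_root q k = gbinom q (2*k) k / qpoch (-q) q k ^ 2"
proof -
  have "gbinom q (2*k) k * qpoch q q k * qpoch q q k = qpoch q (q^2) k * qpoch (q^2) (q^2) k"
    using gbinom_qpoch[of k "2*k" q] by (simp add: qpoch_double)
  then have "gbinom q (2*k) k * qpoch q q k = qpoch q (q^2) k * qpoch (-q) q k"
    by (simp add: qpoch_square)
  then show ?thesis
    unfolding rhs_root_def qpoch_square by (simp add: field_simps power2_eq_square)
qed

lemma rhs_root_power4: "rhs_root q k ^ 4 = rhs_term q k"
  by (simp add: rhs_root_gbinom rhs_term_def power_divide flip: power_mult)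

lemma lhs_weight_gbinom: "lhs_weight q k / q ^ (\<Sum>{..k}) = lhs_term q k"
proof -
  have "qpoch q (q^2) k = rhs_root q k * (qpoch q q k * qpoch (-q) q k)"
    by (simp add: rhs_root_def flip: qpoch_square)
  then have "qpoch q (q^2) k = gbinom q (2*k) k * qpoch q q k / qpoch (-q) q k"
    unfolding rhs_root_gbinom by (simp add: power2_eq_square)
  moreover have "(G * Q / M) ^ 3 / (Q\<^sup>2 * (Q * M)) / X = G ^ 3 / (M ^ 4 * X)" if "Q \<noteq> 0" for G Q M X :: 'a
    using that by (simp add: field_simps power2_eq_square power3_eq_cube power4_eq_xxxx)
  ultimately show ?thesis
    unfolding lhs_weight_def lhs_term_def qpoch_square by simp
qed

lemma lhs_term_step:
  "lhs_term q (Suc k) * ((1 - q ^ (k+1))\<^sup>2 * (1 - q ^ (2*k+2)) * q ^ (k+1)) = lhs_term q k * (1 - q ^ (2*k+1)) ^ 3"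
proof -
  have pw: "q ^ (k+1) = q * q ^ k" "q ^ (2*k+2) = q^2 * (q^2) ^ k" "q ^ (2*k+1) = q * (q^2) ^ k"
    by (simp_all add: power_mult power2_eq_square mult.assoc)
  have ne: "1 - q * q ^ k \<noteq> 0" "1 - q^2 * (q^2) ^ k \<noteq> 0"
    using factor_nonzero[of "k+1"] factor_nonzero[of "2*k+2"] unfolding pw by simp_all
  have s: "q ^ (\<Sum>{..Suc k}) = q ^ (\<Sum>{..k}) * (q * q ^ k)"
    by (simp add: power_add)
  show ?thesis
    unfolding lhs_weight_gbinom[symmetric] lhs_weight_def qpoch_Suc pw s
    using ne by (simp add: divide_simps)
qed

end

section \<open>Block decomposition of longer sums at a root of unity\<close>

lemma sum_lessThan_add:
  fixes f :: "nat \<Rightarrow> 'a::comm_monoid_add"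
  shows "(\<Sum>i<a+b. f i) = (\<Sum>i<a. f i) + (\<Sum>i<b. f (a + i))"
  by (induction b) (simp_all add: ac_simps)

text \<open>A substitute for the q-Lucas theorem at the root of unity.\<close>

lemma periodic_block:
  fixes f A B :: "nat \<Rightarrow> 'a::field"
  assumes "n > 0" and f0: "f 0 = 1"
    and step: "\<And>k. f (Suc k) * B k = f k * A k"
    and B: "\<And>k. \<not> n dvd Suc k \<Longrightarrow> B k \<noteq> 0"
    and per: "\<And>k. A (n + k) = A k" "\<And>k. B (n + k) = B k"
  shows "b < n \<Longrightarrow> f (n * a + b) = f (n * a) * f b"
proof (induction b)
  case (Suc b)
  have per': "A (n * a + k) = A k" "B (n * a + k) = B k" for k
    by (induction a) (simp_all add: per add.assoc)
  have "B b \<noteq> 0"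
    using Suc.prems by (intro B) (auto dest: dvd_imp_le)
  have "f (n * a + Suc b) * B b = f (n * a + b) * A b"
    using step[of "n * a + b"] by (simp add: per')
  also have "\<dots> = f (n * a) * f (Suc b) * B b"
    using Suc step[of b] by (simp add: mult.assoc)
  finally show ?case
    using \<open>B b \<noteq> 0\<close> by simp
qed (simp add: f0)

text \<open>Since \<open>w\<close> is periodic, the block starting at \<open>n * s\<close>
  contributes \<open>f (n * s)\<close> times the first block.\<close>

lemma periodic_block_sum:
  fixes f w :: "nat \<Rightarrow> 'a::field"
  assumes block: "\<And>a b. b < n \<Longrightarrow> f (n * a + b) = f (n * a) * f b"
    and per: "\<And>k. w (n + k) = w k"
    and zero: "(\<Sum>b<n. w b * f b) = 0"
  shows "(\<Sum>k<n*s. w k * f k) = 0"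
proof (induction s)
  case (Suc s)
  have per': "w (n * s + k) = w k" for k
    by (induction s) (simp_all add: per add.assoc)
  have "(\<Sum>b<n. w (n * s + b) * f (n * s + b)) = f (n * s) * (\<Sum>b<n. w b * f b)"
    unfolding sum_distrib_left by (intro sum.cong) (simp_all add: per' block)
  then show ?case
    using Suc zero by (simp add: sum_lessThan_add add.commute[of n])
qed simp

context primitive_root
begin

lemma periodic: "\<zeta> ^ (a * (n + k) + b) = \<zeta> ^ (a * k + b)"
proof -
  have "a * (n + k) + b = n * a + (a * k + b)"
    by (simp add: algebra_simps)
  then show ?thesis
    by (simp add: power_add power_mult)
qed

text \<open>If \<zeta>^i = -1, then \<zeta>^(2*i) = 1, so the odd number n divides i and \<zeta>^i =
  1.\<close>

lemma plus_nonzero: "1 + \<zeta> ^ i \<noteq> 0"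
proof
  assume "1 + \<zeta> ^ i = 0"
  then have i: "\<zeta> ^ i = - 1"
    by (simp add: eq_neg_iff_add_eq_0 add.commute)
  then have "\<zeta> ^ (2 * i) = 1"
    by (simp add: power_mult mult.commute[of 2])
  then have "n dvd 2 * i"
    using root by blast
  moreover have "coprime n 2"
    unfolding n_eq by simp
  ultimately have "n dvd i"
    by (simp add: coprime_dvd_mult_right_iff)
  then have "\<zeta> ^ i = 1"
    using root by blast
  with i show False
    by simp
qed

lemma qpoch_minus_root_nonzero [simp]: "qpoch (-\<zeta>) \<zeta> k \<noteq> 0"
  using plus_nonzero[of "Suc i" for i] by (auto simp: qpoch_def)

lemma tendsto_gbinom: "((\<lambda>q. gbinom q a b) \<longlongrightarrow> gbinom \<zeta> a b) radial"
proof (induction a arbitrary: b)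
  case 0
  show ?case
    by (cases b) simp_all
next
  case (Suc a)
  show ?case
  proof (cases b)
    case (Suc k)
    then show ?thesis
      unfolding Suc gbinom.simps by (intro tendsto_intros tendsto_radial Suc.IH)
  qed simp
qed

lemma tendsto_qpoch_minus: "((\<lambda>q. qpoch (-q) q k) \<longlongrightarrow> qpoch (-\<zeta>) \<zeta> k) radial"
  unfolding qpoch_def by (intro tendsto_intros tendsto_radial)

lemma tendsto_terms:
  "((\<lambda>q. lhs_term q k) \<longlongrightarrow> lhs_term \<zeta> k) radial"
  "((\<lambda>q. rhs_term q k) \<longlongrightarrow> rhs_term \<zeta> k) radial"
  unfolding lhs_term_def rhs_term_def
  by (intro tendsto_intros tendsto_radial tendsto_gbinom tendsto_qpoch_minus; simp)+

text \<open>With denominators cleared, the recurrences for generic q have both sides continuous at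
  \<zeta>, so they survive the limit.\<close>

lemma term_steps:
  "lhs_term \<zeta> (Suc k) * ((1 - \<zeta> ^ (k+1))\<^sup>2 * (1 - \<zeta> ^ (2*k+2)) * \<zeta> ^ (k+1)) = lhs_term \<zeta> k * (1 - \<zeta> ^ (2*k+1)) ^ 3"
  "rhs_term \<zeta> (Suc k) * (1 - \<zeta> ^ (2*k+2)) ^ 4 = rhs_term \<zeta> k * (1 - \<zeta> ^ (2*k+1)) ^ 4"
proof -
  have "((\<lambda>q. lhs_term q (Suc k) * ((1 - q ^ (k+1))\<^sup>2 * (1 - q ^ (2*k+2)) * q ^ (k+1)))
     \<longlongrightarrow> lhs_term \<zeta> (Suc k) * ((1 - \<zeta> ^ (k+1))\<^sup>2 * (1 - \<zeta> ^ (2*k+2)) * \<zeta> ^ (k+1))) radial"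
    by (intro tendsto_intros tendsto_terms tendsto_radial)
  then have 1: "((\<lambda>q. lhs_term q k * (1 - q ^ (2*k+1)) ^ 3)
     \<longlongrightarrow> lhs_term \<zeta> (Suc k) * ((1 - \<zeta> ^ (k+1))\<^sup>2 * (1 - \<zeta> ^ (2*k+2)) * \<zeta> ^ (k+1))) radial"
    by (rule Lim_transform_eventually)
      (use eventually_generic in eventually_elim, rule generic_base.lhs_term_step)
  have 2: "((\<lambda>q. lhs_term q k * (1 - q ^ (2*k+1)) ^ 3) \<longlongrightarrow> lhs_term \<zeta> k * (1 - \<zeta> ^ (2*k+1)) ^ 3) radial"
    by (intro tendsto_intros tendsto_terms tendsto_radial)
  show "lhs_term \<zeta> (Suc k) * ((1 - \<zeta> ^ (k+1))\<^sup>2 * (1 - \<zeta> ^ (2*k+2)) * \<zeta> ^ (k+1)) = lhs_term \<zeta> k * (1 - \<zeta> ^ (2*k+1)) ^ 3"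
    by (rule tendsto_unique[OF radial_nontrivial 1 2])
  have "((\<lambda>q. rhs_term q (Suc k) * (1 - q ^ (2*k+2)) ^ 4) \<longlongrightarrow> rhs_term \<zeta> (Suc k) * (1 - \<zeta> ^ (2*k+2)) ^ 4) radial"
    by (intro tendsto_intros tendsto_terms tendsto_radial)
  then have 1: "((\<lambda>q. rhs_term q k * (1 - q ^ (2*k+1)) ^ 4) \<longlongrightarrow> rhs_term \<zeta> (Suc k) * (1 - \<zeta> ^ (2*k+2)) ^ 4) radial"
  proof (rule Lim_transform_eventually, use eventually_generic in eventually_elim)
    case (elim q)
    then show ?case
      using generic_base.rhs_root_step[OF elim, of k]
      by (simp only: generic_base.rhs_root_power4[OF elim, symmetric] power_mult_distrib[symmetric])
  qed
  have 2: "((\<lambda>q. rhs_term q k * (1 - q ^ (2*k+1)) ^ 4) \<longlongrightarrow> rhs_term \<zeta> k * (1 - \<zeta> ^ (2*k+1)) ^ 4) radial"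
    by (intro tendsto_intros tendsto_terms tendsto_radial)
  show "rhs_term \<zeta> (Suc k) * (1 - \<zeta> ^ (2*k+2)) ^ 4 = rhs_term \<zeta> k * (1 - \<zeta> ^ (2*k+1)) ^ 4"
    by (rule tendsto_unique[OF radial_nontrivial 1 2])
qed

lemma ndvd_double: "\<not> n dvd k \<Longrightarrow> \<not> n dvd 2 * k"
proof -
  have "coprime n 2"
    unfolding n_eq by simp
  then show "\<not> n dvd k \<Longrightarrow> \<not> n dvd 2 * k"
    by (simp add: coprime_dvd_mult_right_iff)
qed

lemma term_0 [simp]: "lhs_term \<zeta> 0 = 1" "rhs_term \<zeta> 0 = 1"
  by (simp_all add: lhs_term_def rhs_term_def)

text \<open>The coefficients of the recurrence depend on k only modulo n, and that of the next term
  vanishes only if n divides k + 1, that is, at the passage to the next block.\<close>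

lemma lhs_block:
  assumes "b < n"
  shows "lhs_term \<zeta> (n * a + b) = lhs_term \<zeta> (n * a) * lhs_term \<zeta> b"
proof (rule periodic_block[where f = "lhs_term \<zeta>" and A = "\<lambda>k. (1 - \<zeta> ^ (2*k+1)) ^ 3"
      and B = "\<lambda>k. (1 - \<zeta> ^ (k+1))\<^sup>2 * (1 - \<zeta> ^ (2*k+2)) * \<zeta> ^ (k+1)", OF n_pos _ term_steps(1) _ _ _ assms])
  show "(1 - \<zeta> ^ (k+1))\<^sup>2 * (1 - \<zeta> ^ (2*k+2)) * \<zeta> ^ (k+1) \<noteq> 0" if "\<not> n dvd Suc k" for k
    using that ndvd_double[OF that] root[of "k+1"] root[of "2*k+2"] by auto
  show "(1 - \<zeta> ^ (2 * (n + k) + 1)) ^ 3 = (1 - \<zeta> ^ (2 * k + 1)) ^ 3" for k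
    unfolding periodic ..
  show "(1 - \<zeta> ^ (n + k + 1))\<^sup>2 * (1 - \<zeta> ^ (2 * (n + k) + 2)) * \<zeta> ^ (n + k + 1)
      = (1 - \<zeta> ^ (k + 1))\<^sup>2 * (1 - \<zeta> ^ (2 * k + 2)) * \<zeta> ^ (k + 1)" for k
    unfolding periodic periodic[of 1 k 1, unfolded mult_1] ..
qed simp

lemma rhs_block:
  assumes "b < n"
  shows "rhs_term \<zeta> (n * a + b) = rhs_term \<zeta> (n * a) * rhs_term \<zeta> b"
proof (rule periodic_block[where f = "rhs_term \<zeta>" and A = "\<lambda>k. (1 - \<zeta> ^ (2*k+1)) ^ 4"
      and B = "\<lambda>k. (1 - \<zeta> ^ (2*k+2)) ^ 4", OF n_pos _ term_steps(2) _ _ _ assms])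
  show "(1 - \<zeta> ^ (2*k+2)) ^ 4 \<noteq> 0" if "\<not> n dvd Suc k" for k
    using ndvd_double[OF that] root[of "2*k+2"] by auto
qed (simp_all only: periodic term_0)

text \<open>For these \<open>j\<close>, \<open>rhs_root\<close> has a simple zero at
  \<zeta>.\<close>

lemma rhs_term_upper: "m < j \<Longrightarrow> j < n \<Longrightarrow> rhs_term \<zeta> j = 0"
proof (rule tendsto_unique[OF radial_nontrivial tendsto_terms(2)])
  assume "m < j" "j < n"
  then have "(j + m) div n = 1" "j div n = 0"
    by (auto simp: n_eq div_nat_eqI)
  then have "((\<lambda>q. rhs_root q j) \<longlongrightarrow> 0) radial"
    using has_order_rhs_root[of j] by (intro has_order_tendsto_0) auto
  then have "((\<lambda>q. rhs_root q j ^ 4) \<longlongrightarrow> 0 ^ 4) radial"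
    by (rule tendsto_power)
  then show "((\<lambda>q. rhs_term q j) \<longlongrightarrow> 0) radial"
    by (rule Lim_transform_eventually[OF back_subst[of "\<lambda>x. (_ \<longlongrightarrow> x) radial"]])
      (simp, use eventually_generic in eventually_elim, rule generic_base.rhs_root_power4)
qed

text \<open>The values \<open>t j\<close> are the limits of \<open>rhs_root q j\<close>; reflection
  j \<mapsto> m - j applies to them because 2*m + 1 = n.\<close>

lemma rhs_sum_zero: "(\<Sum>j\<le>m. (1 - \<zeta> ^ (4*j+1)) * rhs_term \<zeta> j) = 0"
proof -
  define t where "t j = gbinom \<zeta> (2*j) j / qpoch (-\<zeta>) \<zeta> j ^ 2" for j
  have lim: "((\<lambda>q. rhs_root q j) \<longlongrightarrow> t j) radial" for j
  proof -
    have "((\<lambda>q. gbinom q (2*j) j / qpoch (-q) q j ^ 2) \<longlongrightarrow> t j) radial"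
      unfolding t_def by (intro tendsto_intros tendsto_radial tendsto_gbinom tendsto_qpoch_minus) simp
    then show ?thesis
      by (rule Lim_transform_eventually)
        (use eventually_generic in eventually_elim, rule generic_base.rhs_root_gbinom[symmetric])
  qed
  have small: "\<not> n dvd 2*j+1" "\<not> n dvd 2*j+2" if "j < m" for j
    using that n_eq by (auto dest: dvd_imp_le)
  have "(\<Sum>j=0..m. (1 - \<zeta> ^ (4*j+1)) * t j ^ 4) = 0"
  proof (rule reflected_sum_zero)
    show "t j \<noteq> 0" if "j \<le> m" for j
    proof -
      have "(j + m) div n = 0" "j div n = 0"
        using that n_eq by auto
      then obtain L where "L \<noteq> 0" "((\<lambda>q. rhs_root q j) \<longlongrightarrow> L) radial"
        using has_order_rhs_root[of j] by (auto simp: has_order_def)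
      then show ?thesis
        using tendsto_unique[OF radial_nontrivial lim] by metis
    qed
    show "\<zeta> ^ (2*j+1) \<noteq> 1" "\<zeta> ^ (2*j+2) \<noteq> 1" if "j < m" for j
      using small[OF that] root by blast+
    show "\<zeta> ^ (2 * (0 + m) + 1) = 1"
      unfolding root by (simp add: n_eq)
    show "t (Suc j) * (1 - \<zeta> ^ (2*j+2)) = t j * (1 - \<zeta> ^ (2*j+1))" for j
    proof (rule tendsto_unique[OF radial_nontrivial])
      show "((\<lambda>q. rhs_root q j * (1 - q ^ (2*j+1))) \<longlongrightarrow> t j * (1 - \<zeta> ^ (2*j+1))) radial"
        by (intro tendsto_intros lim tendsto_radial)
      have "((\<lambda>q. rhs_root q (Suc j) * (1 - q ^ (2*j+2))) \<longlongrightarrow> t (Suc j) * (1 - \<zeta> ^ (2*j+2))) radial"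
        by (intro tendsto_intros lim tendsto_radial)
      then show "((\<lambda>q. rhs_root q j * (1 - q ^ (2*j+1))) \<longlongrightarrow> t (Suc j) * (1 - \<zeta> ^ (2*j+2))) radial"
        by (rule Lim_transform_eventually)
          (use eventually_generic in eventually_elim, rule generic_base.rhs_root_step)
    qed
  qed simp
  moreover have "t j ^ 4 = rhs_term \<zeta> j" for j
    by (simp add: t_def rhs_term_def power_divide flip: power_mult)
  ultimately show ?thesis
    by (simp add: atLeast0AtMost)
qed

lemma gbinom_difference_tendsto_0:
  "((\<lambda>q. ((\<Sum>k<n. (1 - q ^ (3*k+1)) * lhs_term q k) - (\<Sum>j\<le>m. (1 - q ^ (4*j+1)) * rhs_term q j)) / (1 - q ^ n) ^ 4)
      \<longlongrightarrow> 0) radial"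
proof (rule Lim_transform_eventually[OF difference_tendsto_0], use eventually_generic in eventually_elim)
  case (elim q)
  then interpret generic_base q .
  show ?case
    unfolding lhs_weight_gbinom[symmetric] rhs_root_power4 times_divide_eq_right ..
qed

text \<open>The difference of the two sums tends to 0 even after division by (1 - q^n)^4, so by
  continuity it vanishes at \<zeta>, where the right-hand sum is zero by reflection.\<close>

lemma lhs_sum_zero: "(\<Sum>k<n. (1 - \<zeta> ^ (3*k+1)) * lhs_term \<zeta> k) = 0"
proof -
  let ?D = "\<lambda>q. (\<Sum>k<n. (1 - q ^ (3*k+1)) * lhs_term q k) - (\<Sum>j\<le>m. (1 - q ^ (4*j+1)) * rhs_term q j)"
  have "((\<lambda>q. ?D q / (1 - q ^ n) ^ 4 * (1 - q ^ n) ^ 4) \<longlongrightarrow> 0 * (1 - \<zeta> ^ n) ^ 4) radial"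
    by (intro tendsto_mult gbinom_difference_tendsto_0 tendsto_intros tendsto_radial)
  then have 1: "(?D \<longlongrightarrow> 0 * (1 - \<zeta> ^ n) ^ 4) radial"
    by (rule Lim_transform_eventually) (use eventually_nz in eventually_elim, simp)
  have 2: "(?D \<longlongrightarrow> ?D \<zeta>) radial"
    by (intro tendsto_intros tendsto_radial tendsto_terms)
  have "?D \<zeta> = 0"
    using tendsto_unique[OF radial_nontrivial 1 2] by simp
  then show ?thesis
    using rhs_sum_zero by simp
qed

lemma lhs_sum_multiple_zero: "(\<Sum>k<n*s. (1 - \<zeta> ^ (3*k+1)) * lhs_term \<zeta> k) = 0"
  by (rule periodic_block_sum[OF lhs_block _ lhs_sum_zero]) (simp_all only: periodic)

text \<open>The range consists of u full blocks and an initial segment of length m + 1 of one more.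
  A full block has the same sum as such a segment, because its other terms are zero.\<close>

lemma rhs_sum_multiple_zero: "(\<Sum>j\<le>n*u+m. (1 - \<zeta> ^ (4*j+1)) * rhs_term \<zeta> j) = 0"
proof -
  have U: "{..<n} = {..m} \<union> {Suc m..<n}"
    using n_eq by auto
  have "(\<Sum>j<n. (1 - \<zeta> ^ (4*j+1)) * rhs_term \<zeta> j)
      = (\<Sum>j\<le>m. (1 - \<zeta> ^ (4*j+1)) * rhs_term \<zeta> j) + (\<Sum>j=Suc m..<n. (1 - \<zeta> ^ (4*j+1)) * rhs_term \<zeta> j)"
    unfolding U by (rule sum.union_disjoint) auto
  also have "(\<Sum>j=Suc m..<n. (1 - \<zeta> ^ (4*j+1)) * rhs_term \<zeta> j) = 0"
    by (intro sum.neutral) (auto simp: rhs_term_upper)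
  finally have 0: "(\<Sum>j<n. (1 - \<zeta> ^ (4*j+1)) * rhs_term \<zeta> j) = 0"
    using rhs_sum_zero by simp
  have 1: "(\<Sum>j<n*u. (1 - \<zeta> ^ (4*j+1)) * rhs_term \<zeta> j) = 0"
    by (rule periodic_block_sum[OF rhs_block _ 0]) (simp_all only: periodic)
  have per: "\<zeta> ^ (4 * (n * u + b) + 1) = \<zeta> ^ (4 * b + 1)" for b
  proof (induction u)
    case (Suc u)
    have "4 * (n * Suc u + b) + 1 = 4 * (n + (n * u + b)) + 1"
      by simp
    then show ?case
      using Suc by (simp only: periodic)
  qed simp
  have "(\<Sum>b<Suc m. (1 - \<zeta> ^ (4*(n*u+b)+1)) * rhs_term \<zeta> (n*u+b))
      = rhs_term \<zeta> (n*u) * (\<Sum>b<Suc m. (1 - \<zeta> ^ (4*b+1)) * rhs_term \<zeta> b)"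
    unfolding sum_distrib_left per
  proof (intro sum.cong refl)
    fix b
    assume "b \<in> {..<Suc m}"
    then have "b < n"
      using n_eq m_pos by simp
    then show "(1 - \<zeta> ^ (4*b+1)) * rhs_term \<zeta> (n*u+b) = rhs_term \<zeta> (n*u) * ((1 - \<zeta> ^ (4*b+1)) * rhs_term \<zeta> b)"
      by (simp only: rhs_block mult.left_commute)
  qed
  also have "\<dots> = 0"
    unfolding lessThan_Suc_atMost rhs_sum_zero by simp
  finally have 2: "(\<Sum>b<Suc m. (1 - \<zeta> ^ (4*(n*u+b)+1)) * rhs_term \<zeta> (n*u+b)) = 0" .
  have "{..n*u+m} = {..<n*u+Suc m}"
    by auto
  then show ?thesis
    by (simp only: sum_lessThan_add 1 2 add_0)
qed

end

subsection \<open>Divisibility by cyclotomic polynomials\<close>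

text \<open>Integer polynomials are kept as complex ones, so that integrality and the multiplicities
  of complex roots concern the same objects.\<close>

definition int_poly :: "complex poly \<Rightarrow> bool" where
  "int_poly P \<longleftrightarrow> (\<forall>i. coeff P i \<in> \<int>)"

lemma int_poly_intros:
  "int_poly 0" "int_poly 1" "int_poly [:0, 1:]"
  "int_poly P \<Longrightarrow> int_poly Q \<Longrightarrow> int_poly (P + Q)"
  "int_poly P \<Longrightarrow> int_poly Q \<Longrightarrow> int_poly (P - Q)"
  "int_poly P \<Longrightarrow> int_poly Q \<Longrightarrow> int_poly (P * Q)"
  by (auto simp: int_poly_def coeff_mult coeff_1 coeff_pCons split: nat.splits intro!: Ints_sum Ints_mult)

lemma int_poly_sum: "(\<And>i. i \<in> A \<Longrightarrow> int_poly (f i)) \<Longrightarrow> int_poly (\<Sum>i\<in>A. f i)"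
  by (induction A rule: infinite_finite_induct) (auto intro: int_poly_intros)

lemma int_poly_prod: "(\<And>i. i \<in> A \<Longrightarrow> int_poly (f i)) \<Longrightarrow> int_poly (\<Prod>i\<in>A. f i)"
  by (induction A rule: infinite_finite_induct) (auto intro: int_poly_intros)

lemma int_poly_power: "int_poly P \<Longrightarrow> int_poly (P ^ k)"
  by (induction k) (auto intro: int_poly_intros)

lemma int_poly_eval_1: "int_poly P \<Longrightarrow> poly P 1 \<in> \<int>"
  by (auto simp: int_poly_def poly_altdef intro: Ints_sum)

text \<open>If \<open>i\<close> is the largest index of a non-integral coefficient of
  \<open>M\<close>, then the coefficient of \<open>W * M\<close> at \<open>degree W + i\<close> is
  that coefficient plus an integer.\<close>

lemma int_poly_monic_factor:
  assumes W: "int_poly W" "lead_coeff W = 1" and WM: "int_poly (W * M)"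
  shows "int_poly M"
proof (rule ccontr)
  define bad where "bad = {i. coeff M i \<notin> \<int>}"
  assume "\<not> int_poly M"
  then have "bad \<noteq> {}"
    by (auto simp: int_poly_def bad_def)
  moreover have "bad \<subseteq> {..degree M}"
    using coeff_eq_0[of M] by (force simp: bad_def not_le[symmetric])
  then have fin: "finite bad"
    by (rule finite_subset) simp
  ultimately have i: "Max bad \<in> bad"
    by simp
  define i where "i = Max bad"
  have above: "coeff M j \<in> \<int>" if "j > i" for j
    using that Max_ge[OF fin, of j] by (force simp: i_def bad_def)
  define d where "d = degree W"
  have "coeff (W * M) (d + i) = (\<Sum>k\<le>d+i. coeff W k * coeff M (d + i - k))"
    by (rule coeff_mult)
  also have "\<dots> = coeff W d * coeff M i + (\<Sum>k\<in>{..d+i}-{d}. coeff W k * coeff M (d + i - k))"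
    by (subst sum.remove[of _ d]) auto
  finally have "coeff M i = coeff (W * M) (d + i) - (\<Sum>k\<in>{..d+i}-{d}. coeff W k * coeff M (d + i - k))"
    using W by (simp add: d_def)
  also have "\<dots> \<in> \<int>"
  proof (intro Ints_diff Ints_sum)
    show "coeff (W * M) (d + i) \<in> \<int>"
      using WM by (simp add: int_poly_def)
    show "coeff W k * coeff M (d + i - k) \<in> \<int>" if "k \<in> {..d+i} - {d}" for k
    proof (cases "k < d")
      case True
      then show ?thesis
        using W above[of "d + i - k"] by (auto simp: int_poly_def)
    next
      case False
      then show ?thesis
        using that by (simp add: d_def coeff_eq_0)
    qed
  qed
  finally show False
    using i by (simp add: i_def bad_def)
qed

section \<open>Functions in Z[q] with q and the 1 + q^i inverted\<close>

definition denom_poly :: "nat \<Rightarrow> complex poly" where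
  "denom_poly N = [:0, 1:] * (\<Prod>i<N. 1 + [:0, 1:] ^ Suc i)"

lemma poly_denom: "poly (denom_poly N) q = q * qpoch (-q) q N"
  by (simp add: denom_poly_def qpoch_def poly_prod)

lemma int_poly_denom: "int_poly (denom_poly N)"
  unfolding denom_poly_def by (intro int_poly_intros int_poly_prod int_poly_power)

text \<open>Membership in the ring Z[q] with q and 1 + q^i for 1 \<le> i \<le> N inverted, read as
  functions off the zeros of the denominator. Such a denominator is nonzero at roots of unity of odd
  order and a power of 2 at 1.\<close>

definition regular :: "nat \<Rightarrow> (complex \<Rightarrow> complex) \<Rightarrow> bool" where
  "regular N f \<longleftrightarrow> (\<exists>P s. int_poly P \<and>
     (\<forall>q. poly (denom_poly N) q \<noteq> 0 \<longrightarrow> f q = poly P q / poly (denom_poly N) q ^ s))"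

lemma regularI:
  assumes "int_poly P" "\<And>q. poly (denom_poly N) q \<noteq> 0 \<Longrightarrow> f q * poly (denom_poly N) q ^ s = poly P q"
  shows "regular N f"
  unfolding regular_def
  by (rule exI[of _ P], rule exI[of _ s]) (use assms in \<open>auto simp: field_simps\<close>)

lemma regularE:
  assumes "regular N f"
  obtains P s where "int_poly P" "\<And>q. poly (denom_poly N) q \<noteq> 0 \<Longrightarrow> f q * poly (denom_poly N) q ^ s = poly P q"
proof -
  from assms obtain P s where "int_poly P"
    "\<forall>q. poly (denom_poly N) q \<noteq> 0 \<longrightarrow> f q = poly P q / poly (denom_poly N) q ^ s"
    unfolding regular_def by blast
  then show ?thesis
    by (intro that[of P s]) auto
qed

lemma regular_poly: "int_poly P \<Longrightarrow> (\<And>q. f q = poly P q) \<Longrightarrow> regular N f"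
  by (rule regularI[of P _ _ 0]) auto

lemma regular_base: "regular N (\<lambda>q. 0)" "regular N (\<lambda>q. 1)" "regular N (\<lambda>q. q)"
  by (rule regular_poly[OF int_poly_intros(1)] regular_poly[OF int_poly_intros(2)]
      regular_poly[OF int_poly_intros(3)]; simp)+

lemma regular_arith:
  assumes "regular N f" "regular N g"
  shows "regular N (\<lambda>q. f q + g q)" "regular N (\<lambda>q. f q - g q)" "regular N (\<lambda>q. f q * g q)"
proof -
  obtain P s where P: "int_poly P" "\<And>q. poly (denom_poly N) q \<noteq> 0 \<Longrightarrow> f q * poly (denom_poly N) q ^ s = poly P q"
    using regularE[OF assms(1)] by metis
  obtain Q t where Q: "int_poly Q" "\<And>q. poly (denom_poly N) q \<noteq> 0 \<Longrightarrow> g q * poly (denom_poly N) q ^ t = poly Q q"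
    using regularE[OF assms(2)] by metis
  show "regular N (\<lambda>q. f q + g q)"
    by (rule regularI[of "P * denom_poly N ^ t + Q * denom_poly N ^ s" _ _ "s + t"])
      (auto intro!: int_poly_intros int_poly_power int_poly_denom P(1) Q(1)
        simp flip: P(2) Q(2) simp: power_add algebra_simps poly_power)
  show "regular N (\<lambda>q. f q - g q)"
    by (rule regularI[of "P * denom_poly N ^ t - Q * denom_poly N ^ s" _ _ "s + t"])
      (auto intro!: int_poly_intros int_poly_power int_poly_denom P(1) Q(1)
        simp flip: P(2) Q(2) simp: power_add algebra_simps poly_power)
  show "regular N (\<lambda>q. f q * g q)"
    by (rule regularI[of "P * Q" _ _ "s + t"])
      (auto intro!: int_poly_intros P(1) Q(1) simp flip: P(2) Q(2) simp: power_add mult_ac)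
qed

lemma regular_sum: "(\<And>i. i \<in> A \<Longrightarrow> regular N (f i)) \<Longrightarrow> regular N (\<lambda>q. \<Sum>i\<in>A. f i q)"
proof (induction A rule: infinite_finite_induct)
  case (insert x A)
  then show ?case
    using regular_arith(1)[of N "f x" "\<lambda>q. \<Sum>i\<in>A. f i q"] by simp
qed (simp_all add: regular_base)

lemma regular_power: "regular N f \<Longrightarrow> regular N (\<lambda>q. f q ^ k)"
proof (induction k)
  case 0
  then show ?case
    by (simp add: regular_base)
next
  case (Suc k)
  then show ?case
    using regular_arith(3)[of N f "\<lambda>q. f q ^ k"] by simp
qed

lemma regular_inverse:
  assumes "int_poly G" "\<And>q. f q * poly G q = poly (denom_poly N) q"
  shows "regular N (\<lambda>q. inverse (f q))"
proof (rule regularI[of G _ _ 1])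
  fix q
  assume "poly (denom_poly N) q \<noteq> 0"
  then have "f q \<noteq> 0"
    using assms(2)[of q] by auto
  then show "inverse (f q) * poly (denom_poly N) q ^ 1 = poly G q"
    by (simp flip: assms(2))
qed (rule assms)

lemma regular_gbinom: "regular N (\<lambda>q. gbinom q a b)"
proof -
  have "\<exists>P. int_poly P \<and> (\<forall>q. poly P q = gbinom q a b)"
  proof (induction a arbitrary: b)
    case 0
    show ?case
      by (cases b) (auto intro: exI[of _ 1] exI[of _ 0] int_poly_intros)
  next
    case (Suc a)
    show ?case
    proof (cases b)
      case 0
      then show ?thesis
        by (auto intro: exI[of _ 1] int_poly_intros)
    next
      case (Suc k)
      obtain P Q where "int_poly P" "\<And>q. poly P q = gbinom q a k" "int_poly Q" "\<And>q. poly Q q = gbinom q a (Suc k)"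
        using Suc.IH by metis
      then show ?thesis
        unfolding Suc
        by (intro exI[of _ "P + [:0, 1:] ^ Suc k * Q"]) (auto intro!: int_poly_intros int_poly_power simp del: power_Suc simp: poly_power)
    qed
  qed
  then obtain P where "int_poly P" "\<And>q. gbinom q a b = poly P q"
    by metis
  then show ?thesis
    by (rule regular_poly)
qed

lemma regular_inverse_qpoch:
  assumes "k \<le> N"
  shows "regular N (\<lambda>q. inverse (qpoch (-q) q k))"
proof (rule regular_inverse)
  show "int_poly ([:0, 1:] * (\<Prod>i\<in>{k..<N}. 1 + [:0, 1:] ^ Suc i))"
    by (intro int_poly_intros int_poly_prod int_poly_power)
  fix q :: complex
  have "(\<Prod>i<N. 1 + q * q ^ i) = (\<Prod>i<k. 1 + q * q ^ i) * (\<Prod>i=k..<N. 1 + q * q ^ i)"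
    using assms prod.atLeastLessThan_concat[of 0 k N "\<lambda>i. 1 + q * q ^ i"] by (simp add: atLeast0LessThan)
  then show "qpoch (-q) q k * poly ([:0, 1:] * (\<Prod>i\<in>{k..<N}. 1 + [:0, 1:] ^ Suc i)) q = poly (denom_poly N) q"
    unfolding poly_denom by (simp add: qpoch_def poly_prod mult_ac)
qed

lemma regular_inverse_q: "regular N inverse"
proof (rule regular_inverse[where f = "\<lambda>q. q", simplified])
  show "int_poly (\<Prod>i<N. 1 + [:0, 1:] ^ Suc i)"
    by (intro int_poly_intros int_poly_prod int_poly_power)
  show "q * poly (\<Prod>i<N. 1 + [:0, 1:] ^ Suc i) q = poly (denom_poly N) q" for q
    by (simp add: denom_poly_def)
qed

text \<open>The q-integers 1 + q + ... + q^(3*k) and 1 + q + ... + q^(4*j) replace 1 - q^(3*k+1) and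
  1 - q^(4*j+1), so that q = 1 gives the rational sums of the theorem.\<close>

definition qdiff :: "nat \<Rightarrow> nat \<Rightarrow> 'a::field \<Rightarrow> 'a" where
  "qdiff n m q = (\<Sum>k<n. (\<Sum>i<3*k+1. q ^ i) * lhs_term q k)
     - (\<Sum>j\<le>m. (\<Sum>i<4*j+1. q ^ i) * rhs_term q j)"

lemma regular_qdiff:
  assumes "m \<le> n"
  shows "regular n (qdiff n m)"
proof -
  have geo: "regular n (\<lambda>q. \<Sum>i<k. q ^ i)" for k
    by (intro regular_sum regular_power regular_base)
  have 1: "regular n (\<lambda>q. lhs_term q k)" if "k < n" for k
    unfolding lhs_term_def divide_inverse inverse_mult_distrib power_inverse[symmetric]
    using that by (intro regular_arith(3) regular_power regular_gbinom regular_inverse_qpoch regular_inverse_q) auto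
  have 2: "regular n (\<lambda>q. rhs_term q k)" if "k \<le> m" for k
    unfolding rhs_term_def divide_inverse power_inverse[symmetric]
    using that assms by (intro regular_arith(3) regular_power regular_gbinom regular_inverse_qpoch) auto
  show ?thesis
    unfolding qdiff_def
    by (intro regular_arith(2) regular_sum regular_arith(3) geo 1 2) auto
qed

lemma qdiff_times: "(1 - q) * qdiff n m q
    = (\<Sum>k<n. (1 - q ^ (3*k+1)) * lhs_term q k) - (\<Sum>j\<le>m. (1 - q ^ (4*j+1)) * rhs_term q j)"
proof -
  have geo: "(1 - q) * ((\<Sum>i<k. q ^ i) * x) = (1 - q ^ k) * x" for k x
    by (simp add: one_diff_power_eq mult.assoc)
  show ?thesis
    unfolding qdiff_def right_diff_distrib sum_distrib_left geo ..
qed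

section \<open>Zeros of the q-difference at roots of unity\<close>

context primitive_root
begin

lemma root_ne_1: "\<zeta> \<noteq> 1"
  using root[of 1] n_eq m_pos by auto

lemma denom_root_nonzero: "poly (denom_poly N) \<zeta> \<noteq> 0"
  unfolding poly_denom by simp

lemma qdiff_multiple_zero: "qdiff (n * s) (n * u + m) \<zeta> = 0"
  using qdiff_times[of \<zeta> "n * s" "n * u + m"] root_ne_1
  unfolding lhs_sum_multiple_zero rhs_sum_multiple_zero by simp

text \<open>Let the order k be at most 4 and M the quotient of P by (q - \<zeta>)^k. Since the
  q-difference is o((1 - q^n)^4), M vanishes at \<zeta>, contrary to the choice of k.\<close>

lemma order_numerator:
  assumes P: "\<And>q. poly (denom_poly n) q \<noteq> 0 \<Longrightarrow> qdiff n m q * poly (denom_poly n) q ^ s = poly P q"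
    and "P \<noteq> 0"
  shows "order \<zeta> P \<ge> 5"
proof (rule ccontr)
  define k where "k = order \<zeta> P"
  assume "\<not> order \<zeta> P \<ge> 5"
  then have k: "k \<le> 4"
    by (simp add: k_def)
  obtain M where M: "P = [:-\<zeta>, 1:] ^ k * M" "\<not> [:-\<zeta>, 1:] dvd M"
    using order_decomp[OF \<open>P \<noteq> 0\<close>, of \<zeta>] by (auto simp: k_def)
  have "poly (1 - [:0, 1:] ^ n) \<zeta> = 0"
    by (simp add: poly_power)
  then obtain h where h: "1 - [:0, 1:] ^ n = [:-\<zeta>, 1:] * h"
    unfolding poly_eq_0_iff_dvd by blast
  have hq: "1 - q ^ n = (q - \<zeta>) * poly h q" for q
    using arg_cong[OF h, of "\<lambda>p. poly p q"] by (simp add: poly_power algebra_simps)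
  define E where "E q = (1 - q) * qdiff n m q / (1 - q ^ n) ^ 4" for q :: complex
  have E: "(E \<longlongrightarrow> 0) radial"
    unfolding E_def qdiff_times by (rule gbinom_difference_tendsto_0)
  \<comment> \<open>For generic q this product equals \<open>poly M q * (1 - q)\<close>, and its
    factor \<open>E q\<close> forces the limit 0.\<close>
  have "((\<lambda>q. poly (denom_poly n) q ^ s * E q * (q - \<zeta>) ^ (4 - k) * poly h q ^ 4)
      \<longlongrightarrow> poly (denom_poly n) \<zeta> ^ s * 0 * (\<zeta> - \<zeta>) ^ (4 - k) * poly h \<zeta> ^ 4) radial"
    by (intro tendsto_intros E tendsto_radial)
  then have "((\<lambda>q. poly M q * (1 - q))
      \<longlongrightarrow> poly (denom_poly n) \<zeta> ^ s * 0 * (\<zeta> - \<zeta>) ^ (4 - k) * poly h \<zeta> ^ 4) radial"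
  proof (rule Lim_transform_eventually, use eventually_generic in eventually_elim)
    case (elim q)
    then interpret generic_base q .
    have ne: "1 - q ^ n \<noteq> 0" "q - \<zeta> \<noteq> 0"
      using factor_nonzero[OF n_pos] hq[of q] by auto
    have "poly (denom_poly n) q \<noteq> 0"
      unfolding poly_denom by simp
    then have "(q - \<zeta>) ^ k * (poly M q * (1 - q)) = (1 - q) * qdiff n m q * poly (denom_poly n) q ^ s"
      using P[of q] by (simp add: M(1) poly_power mult_ac)
    also have "\<dots> = poly (denom_poly n) q ^ s * E q * (1 - q ^ n) ^ 4"
      using ne by (simp add: E_def)
    also have "\<dots> = (q - \<zeta>) ^ k * (poly (denom_poly n) q ^ s * E q * (q - \<zeta>) ^ (4 - k) * poly h q ^ 4)"
      using k by (simp add: hq power_mult_distrib mult_ac flip: power_add)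
    finally show ?case
      using ne by simp
  qed
  moreover have "((\<lambda>q. poly M q * (1 - q)) \<longlongrightarrow> poly M \<zeta> * (1 - \<zeta>)) radial"
    by (intro tendsto_intros tendsto_radial)
  ultimately have "poly M \<zeta> * (1 - \<zeta>) = 0"
    using tendsto_unique[OF radial_nontrivial] by fastforce
  then show False
    using M(2) root_ne_1 by (simp add: poly_eq_0_iff_dvd)
qed

end

section \<open>Multiplicities of complex roots and the cyclotomic divisor\<close>

lemma root_of_unity_order:
  fixes z :: "'a::field"
  assumes "z ^ n = 1" "n > 0"
  obtains d where "d > 0" "\<And>i. z ^ i = 1 \<longleftrightarrow> d dvd i"
proof -
  define d where "d = (LEAST d. d > 0 \<and> z ^ d = 1)"
  have d: "d > 0 \<and> z ^ d = 1"
    unfolding d_def by (rule LeastI[of _ n]) (use assms in simp)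
  have least: "d \<le> i" if "i > 0" "z ^ i = 1" for i
    unfolding d_def by (rule Least_le) (use that in simp)
  have "z ^ i = 1 \<longleftrightarrow> d dvd i" for i
  proof -
    have "z ^ i = z ^ (d * (i div d)) * z ^ (i mod d)"
      by (simp flip: power_add)
    also have "\<dots> = z ^ (i mod d)"
      using d by (simp add: power_mult)
    finally have i: "z ^ i = z ^ (i mod d)" .
    have "z ^ (i mod d) = 1 \<longleftrightarrow> i mod d = 0"
    proof
      assume "z ^ (i mod d) = 1"
      then show "i mod d = 0"
        using least[of "i mod d"] mod_less_divisor[of d i] d by linarith
    qed simp
    then show ?thesis
      unfolding i dvd_eq_mod_eq_0 .
  qed
  with d that show ?thesis
    by blast
qed

text \<open>Complex polynomials split into linear factors, so inclusion of the root multisets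
  suffices.\<close>

lemma order_le_imp_dvd:
  fixes P Q :: "complex poly"
  assumes "P \<noteq> 0" "Q \<noteq> 0" "\<And>z. order z P \<le> order z Q"
  shows "P dvd Q"
proof -
  have "proots P \<subseteq># proots Q"
    using assms by (simp add: subseteq_mset_def)
  then have "(\<Prod>x\<in>#proots P. [:-x, 1:]) dvd (\<Prod>x\<in>#proots Q. [:-x, 1:])"
    by (intro prod_mset_subset_imp_dvd image_mset_subseteq_mono)
  then have "smult (lead_coeff P) (\<Prod>x\<in>#proots P. [:-x, 1:]) dvd smult (lead_coeff Q) (\<Prod>x\<in>#proots Q. [:-x, 1:])"
    using assms by (simp add: smult_dvd_iff dvd_smult)
  then show ?thesis
    by (simp only: complex_poly_decompose_multiset)
qed

lemma order_power: "P \<noteq> 0 \<Longrightarrow> order z (P ^ k) = k * order (z::complex) P"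
  by (induction k) (simp_all add: order_mult)

abbreviation X :: "complex poly" where "X \<equiv> [:0, 1:]"

lemma lead_coeff_X_power_minus_1: "k > 0 \<Longrightarrow> lead_coeff (X ^ k - 1) = 1"
proof -
  assume "k > 0"
  then have "lead_coeff (- 1 + X ^ k) = lead_coeff (X ^ k)"
    by (intro lead_coeff_add_le) (simp add: degree_power_eq)
  then show ?thesis
    by (simp add: lead_coeff_power)
qed

text \<open>The derivative k X^(k-1) can vanish only at 0, which is not a root, so all roots are
  simple.\<close>

lemma order_X_power_minus_1_le: "k > 0 \<Longrightarrow> order z (X ^ k - 1) \<le> 1"
proof -
  assume k: "k > 0"
  have "pderiv (X ^ k - 1) = smult (of_nat k) (X ^ (k - 1))"
    using k by (cases k) (simp_all add: pderiv_diff pderiv_power_Suc pderiv_pCons del: power_Suc)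
  then have "rsquarefree (X ^ k - 1)"
    unfolding rsquarefree_roots using k by (auto simp: poly_power power_0_left)
  then show ?thesis
    unfolding rsquarefree_def by (metis le_refl zero_le_one)
qed

text \<open>For prime \<open>p\<close> this is the product of the fifth power of the cyclotomic polynomial of order
  \<open>p^r\<close> and the cyclotomic polynomials of orders \<open>p, \<dots>, p^(r-1)\<close>.\<close>

definition cyclo_factor :: "nat \<Rightarrow> nat \<Rightarrow> complex poly" where
  "cyclo_factor p r = (\<Sum>i<p. (X ^ (p ^ (r - 1))) ^ i) ^ 4 * (\<Sum>i<p ^ r. X ^ i)"

lemma cyclo_factor_properties:
  assumes "prime p" "odd p" "r \<ge> 1"
  shows "int_poly (cyclo_factor p r)" "lead_coeff (cyclo_factor p r) = 1"
    "poly (cyclo_factor p r) 1 = of_nat (p ^ (r + 4))"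
    "order z (cyclo_factor p r) \<le> (if z ^ (p ^ r) \<noteq> 1 \<or> z = 1 then 0 else if z ^ (p ^ (r - 1)) = 1 then 1 else 5)"
proof -
  \<comment> \<open>\<open>A\<close> is X^(p^r) - 1 divided by X^(p^(r-1)) - 1, the cyclotomic
    polynomial of order p^r, and \<open>B\<close> is the quotient by X - 1. As divisors of X^(p^r) -
    1 both have only simple roots; their values at 1 are p and p^r.\<close>
  define A where "A = (\<Sum>i<p. (X ^ (p ^ (r - 1))) ^ i)"
  define B where "B = (\<Sum>i<p ^ r. X ^ i)"
  have AB: "cyclo_factor p r = A ^ 4 * B"
    by (simp add: cyclo_factor_def A_def B_def)
  have p0: "p > 0"
    using assms by (simp add: prime_gt_0_nat)
  then have pk: "p ^ k > 0" for k
    by simp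
  have pr: "p ^ (r - 1) * p = p ^ r"
    using assms by (cases r) auto
  have B: "X ^ (p ^ r) - 1 = (X - 1) * B"
    unfolding B_def by (rule power_diff_1_eq)
  have A: "X ^ (p ^ r) - 1 = (X ^ (p ^ (r - 1)) - 1) * A"
    unfolding A_def power_diff_1_eq[symmetric] power_mult[symmetric] pr ..
  have lead: "lead_coeff (X ^ (p ^ k) - 1) = 1" for k
    by (rule lead_coeff_X_power_minus_1[OF pk])
  have lB: "lead_coeff B = 1"
    using lead[of r] lead_coeff_X_power_minus_1[of 1] unfolding B lead_coeff_mult by simp
  have lA: "lead_coeff A = 1"
    using lead[of r] lead[of "r - 1"] unfolding A lead_coeff_mult by simp
  show "int_poly (cyclo_factor p r)"
    unfolding cyclo_factor_def by (intro int_poly_intros int_poly_power int_poly_sum)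
  show "lead_coeff (cyclo_factor p r) = 1"
    unfolding AB lead_coeff_mult lead_coeff_power lA lB by simp
  have A1: "poly A 1 = of_nat p" and B1: "poly B 1 = of_nat (p ^ r)"
    by (simp_all add: A_def B_def poly_sum poly_power)
  show "poly (cyclo_factor p r) 1 = of_nat (p ^ (r + 4))"
    unfolding AB by (simp add: A1 B1 poly_power power_add)
  have ne: "A \<noteq> 0" "B \<noteq> 0"
    using lA lB by auto
  have "order z (X ^ (p ^ r) - 1) \<le> 1"
    by (rule order_X_power_minus_1_le[OF pk])
  moreover have ne': "X ^ (p ^ r) - 1 \<noteq> 0"
    using lead[of r] by auto
  ultimately have oA: "order z A \<le> 1" and oB: "order z B \<le> 1"
    using dvd_imp_order_le[OF ne', of A z] dvd_imp_order_le[OF ne', of B z] A B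
    by (metis dvd_triv_right le_trans)+
  have o: "order z (cyclo_factor p r) = 4 * order z A + order z B"
    unfolding AB using ne by (simp add: order_mult order_power)
  show "order z (cyclo_factor p r) \<le> (if z ^ (p ^ r) \<noteq> 1 \<or> z = 1 then 0 else if z ^ (p ^ (r - 1)) = 1 then 1 else 5)"
  proof -
    consider "z ^ (p ^ r) \<noteq> 1 \<or> z = 1" | "z ^ (p ^ r) = 1" "z \<noteq> 1" "z ^ (p ^ (r - 1)) = 1"
      | "z ^ (p ^ r) = 1" "z \<noteq> 1" "z ^ (p ^ (r - 1)) \<noteq> 1"
      by blast
    then show ?thesis
    proof cases
      case 1
      have "poly A z \<noteq> 0 \<and> poly B z \<noteq> 0"
      proof (cases "z = 1")
        case True
        then show ?thesis
          using A1 B1 p0 by simp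
      next
        case False
        then have "poly (X ^ (p ^ r) - 1) z \<noteq> 0"
          using 1 by (simp add: poly_power)
        then show ?thesis
          using A B by (metis mult_eq_0_iff poly_mult)
      qed
      then show ?thesis
        using 1 o by (auto simp: order_0I)
    next
      case 2
      have "poly A z = of_nat p"
        using 2 by (simp add: A_def poly_sum poly_power)
      then have "order z A = 0"
        using p0 by (intro order_0I) simp
      then show ?thesis
        using 2 o oB by simp
    next
      case 3
      then show ?thesis
        using o oA oB by simp
    qed
  qed
qed

text \<open>Multiplicities are compared at every z of order d > 1 dividing p^r. If d divides
  p^(r-1), a simple zero is enough and comes from the block decomposition; if d = p^r,
  \<open>order_numerator\<close> gives order at least 5.\<close>

lemma qdiff_numerator_dvd:
  assumes p: "prime p" "odd p" "r \<ge> 1"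
    and P: "\<And>q. poly (denom_poly (p ^ r)) q \<noteq> 0 \<Longrightarrow>
      qdiff (p ^ r) ((p ^ r - 1) div 2) q * poly (denom_poly (p ^ r)) q ^ s = poly P q"
  shows "cyclo_factor p r dvd P"
proof (cases "P = 0")
  case False
  define n where "n = p ^ r"
  have n: "n > 0" "odd n"
    using p by (auto simp: n_def prime_gt_0_nat)
  show ?thesis
  proof (rule order_le_imp_dvd)
    show "cyclo_factor p r \<noteq> 0"
      using cyclo_factor_properties(2)[OF p] by auto
    fix z :: complex
    show "order z (cyclo_factor p r) \<le> order z P"
    proof (cases "z ^ n \<noteq> 1 \<or> z = 1")
      case True
      then show ?thesis
        using cyclo_factor_properties(4)[OF p, of z] by (simp add: n_def)
    next
      case False
      then have z: "z ^ n = 1" "z \<noteq> 1"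
        by auto
      obtain d where d: "d > 0" "\<And>i. z ^ i = 1 \<longleftrightarrow> d dvd i"
        using root_of_unity_order[OF z(1) n(1)] by blast
      then have "d dvd n"
        using z by blast
      then obtain t where t: "n = d * t"
        by blast
      have "odd d" "odd t"
        using n t by auto
      then obtain m u where m: "d = 2 * m + 1" and u: "t = 2 * u + 1"
        by (elim oddE)
      have "m > 0"
        using d(2)[of 1] z m by (cases m) auto
      \<comment> \<open>The order d of z, which may be smaller than p^r, plays the part of the
        locale parameter \<open>n\<close>.\<close>
      interpret primitive_root z m d
        by unfold_locales (use m \<open>m > 0\<close> d in auto)
      show ?thesis
      proof (cases "z ^ (p ^ (r - 1)) = 1")
        case True
        \<comment> \<open>Since n = d*(2*u+1) and d = 2*m+1, the upper limit (n-1)/2 has the shape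
          treated in \<open>rhs_sum_multiple_zero\<close>.\<close>
        have "n = 2 * (d * u + m) + 1"
          by (simp add: t u m algebra_simps)
        then have "(n - 1) div 2 = d * u + m"
          by simp
        then have "qdiff n ((n - 1) div 2) z = 0"
          using qdiff_multiple_zero[of t u] t by simp
        then have "poly P z = 0"
          using P[of z] denom_root_nonzero by (simp add: n_def)
        then have "order z P \<ge> 1"
          using \<open>P \<noteq> 0\<close> by (simp add: order_root Suc_le_eq)
        then show ?thesis
          using cyclo_factor_properties(4)[OF p, of z] True z by (simp add: n_def)
      next
        case False
        \<comment> \<open>A divisor of p^r that does not divide p^(r-1) is p^r itself.\<close>
        obtain k where k: "k \<le> r" "d = p ^ k"
          using \<open>d dvd n\<close> p(1) unfolding n_def divides_primepow_nat[OF p(1)] by blast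
        have "\<not> k \<le> r - 1"
        proof
          assume "k \<le> r - 1"
          then have "d dvd p ^ (r - 1)"
            unfolding k by (rule le_imp_power_dvd)
          then show False
            using False d(2) by blast
        qed
        then have "k = r"
          using k by simp
        then have "d = n"
          using k by (simp add: n_def)
        moreover from this have "(n - 1) div 2 = m"
          using m by simp
        ultimately have "order z P \<ge> 5"
          using order_numerator[OF _ \<open>P \<noteq> 0\<close>, of s] P by (simp add: n_def)
        then show ?thesis
          using cyclo_factor_properties(4)[OF p, of z] by (auto split: if_splits)
      qed
    qed
  qed (rule False)
qed simp

section \<open>Specialisation to q = 1 and rational congruences\<close>

lemma pochhammer_half: "pochhammer (1/2 :: rat) k / pochhammer 1 k = of_nat (2*k choose k) / 4 ^ k"
proof -
  have "fact (2*k) = (2 ^ (2*k) * pochhammer (1/2) k * fact k :: rat)"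
    by (rule fact_double)
  moreover have "(of_nat (2*k choose k) :: rat) = fact (2*k) / (fact k * fact k)"
    by (subst binomial_fact) simp_all
  moreover have "2 ^ (2*k) = (4 ^ k :: rat)"
    by (simp add: power_mult)
  ultimately show ?thesis
    by (simp add: field_simps flip: pochhammer_fact)
qed

text \<open>With c the central binomial coefficient, the terms at 1 are c^3 / 2^(4*k) = (c / 4^k)^3
  * 4^k and c^4 / 2^(8*k) = (c / 4^k)^4.\<close>

lemma terms_at_1:
  "lhs_term (1::complex) k = of_rat (pochhammer (1/2) k ^ 3 / pochhammer 1 k ^ 3 * 4 ^ k)"
  "rhs_term (1::complex) k = of_rat (pochhammer (1/2) k ^ 4 / pochhammer 1 k ^ 4)"
proof -
  have q: "qpoch (- 1) (1::complex) k = 2 ^ k"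
    by (simp add: qpoch_def)
  have swap: "(x ^ k) ^ i = (x ^ i) ^ k" for x :: complex and i
    by (metis power_mult mult.commute)
  have pw: "(2 ^ k) ^ 4 = (16 ^ k :: complex)" "(2 ^ k) ^ 8 = (256 ^ k :: complex)"
    "(4 ^ k) ^ 4 = (256 ^ k :: complex)" "(4 ^ k) ^ 3 = (16 ^ k * 4 ^ k :: complex)"
    unfolding swap[of _ 4] swap[of _ 8] swap[of _ 3] by (simp_all flip: power_mult_distrib)
  show "lhs_term (1::complex) k = of_rat (pochhammer (1/2) k ^ 3 / pochhammer 1 k ^ 3 * 4 ^ k)"
    unfolding power_divide[symmetric] pochhammer_half lhs_term_def gbinom_1 q
    by (simp add: of_rat_mult of_rat_divide of_rat_power power_divide pw)
  show "rhs_term (1::complex) k = of_rat (pochhammer (1/2) k ^ 4 / pochhammer 1 k ^ 4)"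
    unfolding power_divide[symmetric] pochhammer_half rhs_term_def gbinom_1 q
    by (simp add: of_rat_divide of_rat_power power_divide pw)
qed

text \<open>By the assumed equation the reduced denominator of (a - b) / p^k divides 2^t, so the odd
  prime p cannot divide it.\<close>

lemma rat_congI:
  assumes "prime p" "odd p" and eq: "(a - b) * 2 ^ t = of_nat (p ^ k) * of_int z"
  shows "rat_cong a b p k"
  unfolding rat_cong_def
proof
  define x where "x = (a - b) / of_nat (p ^ k)"
  obtain u v where uv: "quotient_of x = (u, v)"
    by (cases "quotient_of x")
  assume "int p dvd snd (quotient_of ((a - b) / of_nat (p ^ k)))"
  then have dvd: "int p dvd v"
    using uv by (simp add: x_def)
  have v: "v > 0" "coprime u v" "of_int u = x * of_int v"
    using quotient_of_denom_pos[OF uv] quotient_of_coprime[OF uv] quotient_of_div[OF uv] by auto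
  have x:  "x * 2 ^ t = of_int z"
    using eq prime_gt_0_nat[OF assms(1)] by (simp add: x_def field_simps)
  have "of_int (u * 2 ^ t) = (of_int (z * v) :: rat)"
    unfolding of_int_mult v(3) x[symmetric] by simp
  then have "u * 2 ^ t = z * v"
    by (simp only: of_int_eq_iff)
  then have "v dvd u * 2 ^ t"
    by simp
  then have "v dvd 2 ^ t"
    using v(2) by (simp add: coprime_dvd_mult_right_iff coprime_commute)
  then have "int p dvd 2 ^ t"
    using dvd dvd_trans by blast
  then have "int p dvd int (2 ^ t)"
    by simp
  then have "p dvd 2 ^ t"
    unfolding int_dvd_int_iff .
  then have "p dvd 2"
    using assms(1) prime_dvd_power by blast
  then have "p = 2"
    using assms(1) two_is_prime_nat primes_dvd_imp_eq by blast
  then show False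
    using assms(2) by simp
qed

theorem theorem1p3:
  fixes p r :: nat
  assumes "prime p" and "odd p" and "r \<ge> 1"
  shows "rat_cong
    (\<Sum>k<p ^ r. (3 * of_nat k + 1) * (pochhammer (1/2::rat) k) ^ 3
        / (pochhammer (1::rat) k) ^ 3 * 4 ^ k)
    (\<Sum>k\<le>(p ^ r - 1) div 2. (4 * of_nat k + 1) * (pochhammer (1/2::rat) k) ^ 4
        / (pochhammer (1::rat) k) ^ 4)
    p (r + 4)"
    (is "rat_cong ?L ?R p (r + 4)")
proof -
  define n m where nm: "n = p ^ r" "m = (p ^ r - 1) div 2"
  have "m \<le> n"
    unfolding nm by simp
  then obtain P s where P: "int_poly P"
    "\<And>q. poly (denom_poly n) q \<noteq> 0 \<Longrightarrow> qdiff n m q * poly (denom_poly n) q ^ s = poly P q"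
    using regularE[OF regular_qdiff] by metis
  then have "cyclo_factor p r dvd P"
    using qdiff_numerator_dvd[OF assms] unfolding nm by blast
  then obtain M where M: "P = cyclo_factor p r * M"
    by blast
  \<comment> \<open>The divisor is monic, so the cofactor is again integral; this turns divisibility
    of polynomials into divisibility of their values at 1.\<close>
  have "int_poly M"
    using int_poly_monic_factor[OF cyclo_factor_properties(1,2)[OF assms]] P(1) unfolding M by blast
  then obtain z where z: "poly M 1 = of_int z"
    using int_poly_eval_1 by (auto elim: Ints_cases)
  have den: "poly (denom_poly n) 1 = 2 ^ n"
    by (simp add: poly_denom qpoch_def)
  have "qdiff n m (1::complex) * (2 ^ n) ^ s = poly P 1"
    using P(2)[of 1] unfolding den by simp
  also have "\<dots> = of_nat (p ^ (r + 4)) * of_int z"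
    unfolding M poly_mult cyclo_factor_properties(3)[OF assms] z ..
  also have "qdiff n m (1::complex) = of_rat (?L - ?R)"
    unfolding qdiff_def terms_at_1 nm
    by (simp add: of_rat_diff of_rat_sum of_rat_mult of_rat_divide of_rat_add of_rat_power mult.assoc add.commute[of 1])
  finally have "of_rat ((?L - ?R) * 2 ^ (n * s)) = (of_rat (of_nat (p ^ (r + 4)) * of_int z) :: complex)"
    by (simp only: of_rat_mult of_rat_power of_rat_numeral_eq of_rat_of_nat_eq of_rat_of_int_eq power_mult)
  then have "(?L - ?R) * 2 ^ (n * s) = of_nat (p ^ (r + 4)) * of_int z"
    by (simp only: of_rat_eq_iff)
  then show ?thesis
    by (rule rat_congI[OF assms(1,2)])
qed

end
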